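(* For any polarity $P=(X,Y,R)$ there exists an ultrafilter $U$ (on some set $I$) and an embedding of the canonical extension $(P^+)^\sigma$ of the lattice $P^+$ into the stable set lattice $(P^U)^+$ of the ultrapower $P^U$.
   Context: A polarity is a triple $P=(X,Y,R)$ with $R\subseteq X\times Y$. For $A\subseteq X$ let $\rho A=\{y\in Y:\forall x\in A,\ xRy\}$, for $B\subseteq Y$ let $\lambda B=\{x\in X:\forall y\in B,\ xRy\}$; $A$ is stable if $\lambda\rho A=A$. $P^+$ is the complete lattice of stable subsets of $X$ under inclusion (meets are intersections, $\bigvee G=\lambda\rho(\bigcup G)$). The ultrapower $P^U=(X^I/U,Y^I/U,R^U)$ has $f^UR^Ug^U$ iff $\{i: f(i)Rg(i)\}\in U$. All lattices are bounded. A canonical extension of a lattice $\mathbb{L}$ is a complete lattice $\mathbb{L}^\sigma$ with a lattice embedding $e\colon\mathbb{L}\to\mathbb{L}^\sigma$ that is dense (every element is a join of meets of elements of $e[\mathbb{L}]$ and a meet of joins of elements of $e[\mathbb{L}]$) and compact (for $S,T\subseteq\mathbb{L}$, $\bigwedge e[S]\le\bigvee e[T]$ implies $\bigwedge S'\le\bigvee T'$ for some finite $S'\subseteq S$, $T'\subseteq T$). *)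

theory Defs
  imports Complex_Main "HOL-Library.FuncSet" "HOL-Algebra.Complete_Lattice"
begin

section \<open>Polarities and their stable set lattices\<close>

record ('x, 'y) polarity =
  pol_X :: "'x set"
  pol_Y :: "'y set"
  pol_R :: "('x \<times> 'y) set"

definition is_polarity :: "('x, 'y) polarity \<Rightarrow> bool" where
  "is_polarity P \<longleftrightarrow> pol_R P \<subseteq> pol_X P \<times> pol_Y P"

definition rho :: "('x, 'y) polarity \<Rightarrow> 'x set \<Rightarrow> 'y set" where
  "rho P A = {y \<in> pol_Y P. \<forall>x\<in>A. (x, y) \<in> pol_R P}"

definition lam :: "('x, 'y) polarity \<Rightarrow> 'y set \<Rightarrow> 'x set" where
  "lam P B = {x \<in> pol_X P. \<forall>y\<in>B. (x, y) \<in> pol_R P}"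

definition stable_set :: "('x, 'y) polarity \<Rightarrow> 'x set \<Rightarrow> bool" where
  "stable_set P A \<longleftrightarrow> A \<subseteq> pol_X P \<and> lam P (rho P A) = A"

definition stable_lattice :: "('x, 'y) polarity \<Rightarrow> 'x set gorder" where
  "stable_lattice P = \<lparr>carrier = {A. stable_set P A}, eq = (=), le = (\<subseteq>)\<rparr>"


section \<open>Ultrapowers of polarities\<close>

text \<open>
  An ultrafilter on a set \<open>I\<close> is represented by a library filter on the ambient type that
  contains \<open>I\<close>; a subset \<open>{i \<in> I. Q i}\<close> of \<open>I\<close> belongs to it iff \<^term>\<open>eventually Q U\<close>.
\<close>

definition ultrafilter_on :: "'i set \<Rightarrow> 'i filter \<Rightarrow> bool" where
  "ultrafilter_on I U \<longleftrightarrow>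
     U \<noteq> bot \<and> U \<le> principal I \<and> (\<forall>Q. eventually Q U \<or> eventually (\<lambda>i. \<not> Q i) U)"

definition upow_eq :: "'i set \<Rightarrow> 'i filter \<Rightarrow> 'a set \<Rightarrow> (('i \<Rightarrow> 'a) \<times> ('i \<Rightarrow> 'a)) set" where
  "upow_eq I U A = {(f, g). f \<in> I \<rightarrow>\<^sub>E A \<and> g \<in> I \<rightarrow>\<^sub>E A \<and> (\<forall>\<^sub>F i in U. f i = g i)}"

abbreviation upow_class :: "'i set \<Rightarrow> 'i filter \<Rightarrow> 'a set \<Rightarrow> ('i \<Rightarrow> 'a) \<Rightarrow> ('i \<Rightarrow> 'a) set" where
  "upow_class I U A f \<equiv> upow_eq I U A `` {f}"

definition upow_set :: "'i set \<Rightarrow> 'i filter \<Rightarrow> 'a set \<Rightarrow> ('i \<Rightarrow> 'a) set set" where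
  "upow_set I U A = (I \<rightarrow>\<^sub>E A) // upow_eq I U A"

definition ultrapower ::
  "'i set \<Rightarrow> 'i filter \<Rightarrow> ('x, 'y) polarity \<Rightarrow> (('i \<Rightarrow> 'x) set, ('i \<Rightarrow> 'y) set) polarity" where
  "ultrapower I U P =
     \<lparr>pol_X = upow_set I U (pol_X P),
      pol_Y = upow_set I U (pol_Y P),
      pol_R = {(upow_class I U (pol_X P) f, upow_class I U (pol_Y P) g) | f g.
                 f \<in> I \<rightarrow>\<^sub>E pol_X P \<and> g \<in> I \<rightarrow>\<^sub>E pol_Y P \<and> (\<forall>\<^sub>F i in U. (f i, g i) \<in> pol_R P)}\<rparr>"


section \<open>Canonical extensions of bounded lattices\<close>

text \<open>All lattices are bounded, so homomorphisms preserve the bounds.\<close>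

definition lattice_embedding ::
  "('a, 'c) gorder_scheme \<Rightarrow> ('b, 'd) gorder_scheme \<Rightarrow> ('a \<Rightarrow> 'b) \<Rightarrow> bool" where
  "lattice_embedding L M h \<longleftrightarrow>
     bounded_lattice L \<and> bounded_lattice M \<and>
     h \<in> carrier L \<rightarrow> carrier M \<and> inj_on h (carrier L) \<and>
     join_pres L M h \<and> meet_pres L M h \<and>
     h \<bottom>\<^bsub>L\<^esub> = \<bottom>\<^bsub>M\<^esub> \<and> h \<top>\<^bsub>L\<^esub> = \<top>\<^bsub>M\<^esub>"

text \<open>
  The sets of lattice elements below may be empty: the empty meet is the top element and the
  empty join is the bottom element.
\<close>

definition dense_in ::
  "('a, 'c) gorder_scheme \<Rightarrow> ('b, 'd) gorder_scheme \<Rightarrow> ('a \<Rightarrow> 'b) \<Rightarrow> bool" where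
  "dense_in L C e \<longleftrightarrow> (\<forall>z \<in> carrier C.
     (\<exists>\<S> \<subseteq> Pow (carrier L). z = \<Squnion>\<^bsub>C\<^esub> {\<Sqinter>\<^bsub>C\<^esub> (e ` S) | S. S \<in> \<S>}) \<and>
     (\<exists>\<T> \<subseteq> Pow (carrier L). z = \<Sqinter>\<^bsub>C\<^esub> {\<Squnion>\<^bsub>C\<^esub> (e ` T) | T. T \<in> \<T>}))"

definition compact_in ::
  "('a, 'c) gorder_scheme \<Rightarrow> ('b, 'd) gorder_scheme \<Rightarrow> ('a \<Rightarrow> 'b) \<Rightarrow> bool" where
  "compact_in L C e \<longleftrightarrow> (\<forall>S T. S \<subseteq> carrier L \<and> T \<subseteq> carrier L \<and>
     \<Sqinter>\<^bsub>C\<^esub> (e ` S) \<sqsubseteq>\<^bsub>C\<^esub> \<Squnion>\<^bsub>C\<^esub> (e ` T) \<longrightarrow>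
     (\<exists>S' T'. finite S' \<and> S' \<subseteq> S \<and> finite T' \<and> T' \<subseteq> T \<and> \<Sqinter>\<^bsub>L\<^esub> S' \<sqsubseteq>\<^bsub>L\<^esub> \<Squnion>\<^bsub>L\<^esub> T'))"

definition canonical_extension ::
  "('a, 'c) gorder_scheme \<Rightarrow> ('b, 'd) gorder_scheme \<Rightarrow> ('a \<Rightarrow> 'b) \<Rightarrow> bool" where
  "canonical_extension L C e \<longleftrightarrow>
     complete_lattice C \<and> lattice_embedding L C e \<and> dense_in L C e \<and> compact_in L C e"


section \<open>Basic facts\<close>

lemma mem_lam_rho: "A \<subseteq> pol_X P \<Longrightarrow> A \<subseteq> lam P (rho P A)"
  by (auto simp: rho_def lam_def)

lemma lam_rho_mono: "A \<subseteq> B \<Longrightarrow> lam P (rho P A) \<subseteq> lam P (rho P B)"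
  by (fastforce simp: rho_def lam_def)

lemma stable_lam: "B \<subseteq> pol_Y P \<Longrightarrow> stable_set P (lam P B)"
  by (fastforce simp: stable_set_def rho_def lam_def)

lemma rho_subset: "rho P A \<subseteq> pol_Y P"
  by (auto simp: rho_def)

lemma stable_lattice_least:
  assumes "G \<subseteq> carrier (stable_lattice P)"
  shows "least (stable_lattice P) (lam P (rho P (\<Union>G))) (Upper (stable_lattice P) G)"
proof -
  have "\<Union>G \<subseteq> pol_X P" using assms by (auto simp: stable_lattice_def stable_set_def)
  then have 1: "\<Union>G \<subseteq> lam P (rho P (\<Union>G))" by (rule mem_lam_rho)
  have 2: "stable_set P (lam P (rho P (\<Union>G)))" by (rule stable_lam[OF rho_subset])
  have 3: "lam P (rho P (\<Union>G)) \<subseteq> B" if "stable_set P B" "\<And>A. A \<in> G \<Longrightarrow> A \<subseteq> B" for B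
  proof -
    have "lam P (rho P (\<Union>G)) \<subseteq> lam P (rho P B)" by (rule lam_rho_mono) (use that in blast)
    then show ?thesis using that by (simp add: stable_set_def)
  qed
  show ?thesis
    using 1 2 3 assms unfolding least_def Upper_def
    by (simp add: stable_lattice_def) blast
qed

lemma stable_Inter:
  assumes "\<And>A. A \<in> G \<Longrightarrow> stable_set P A"
  shows "stable_set P (pol_X P \<inter> \<Inter>G)"
proof -
  have "lam P (rho P (pol_X P \<inter> \<Inter>G)) \<subseteq> A" if "A \<in> G" for A
    using lam_rho_mono[of "pol_X P \<inter> \<Inter>G" A P] assms[OF that] that
    by (auto simp: stable_set_def)
  moreover have "lam P (rho P (pol_X P \<inter> \<Inter>G)) \<subseteq> pol_X P" by (auto simp: lam_def)
  ultimately show ?thesis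
    using mem_lam_rho[of "pol_X P \<inter> \<Inter>G" P] unfolding stable_set_def by auto
qed

lemma stable_lattice_greatest:
  assumes "G \<subseteq> carrier (stable_lattice P)"
  shows "greatest (stable_lattice P) (pol_X P \<inter> \<Inter>G) (Lower (stable_lattice P) G)"
proof -
  have "stable_set P (pol_X P \<inter> \<Inter>G)"
    by (rule stable_Inter) (use assms in \<open>auto simp: stable_lattice_def\<close>)
  moreover have "B \<subseteq> pol_X P \<inter> \<Inter>G" if "stable_set P B" "\<And>A. A \<in> G \<Longrightarrow> B \<subseteq> A" for B
    using that by (auto simp: stable_set_def)
  ultimately show ?thesis
    using assms unfolding greatest_def Lower_def
    by (simp add: stable_lattice_def) blast
qed

lemma partial_order_stable_lattice: "partial_order (stable_lattice P)"
  by unfold_locales (auto simp: stable_lattice_def)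

lemma complete_lattice_stable_lattice: "complete_lattice (stable_lattice P)"
  by (rule partial_order.complete_latticeI[OF partial_order_stable_lattice])
     (use stable_lattice_least stable_lattice_greatest in blast)+

lemma bounded_lattice_of_complete:
  assumes "complete_lattice C"
  shows "bounded_lattice C"
proof -
  interpret complete_lattice C by fact
  show ?thesis by unfold_locales
qed

lemma stable_lattice_sup:
  assumes "G \<subseteq> carrier (stable_lattice P)"
  shows "\<Squnion>\<^bsub>stable_lattice P\<^esub> G = lam P (rho P (\<Union>G))"
  unfolding sup_def
  by (rule some_equality)
     (use stable_lattice_least[OF assms] partial_order.least_unique[OF partial_order_stable_lattice]
       in blast)+

lemma stable_lattice_inf:
  assumes "G \<subseteq> carrier (stable_lattice P)"
  shows "\<Sqinter>\<^bsub>stable_lattice P\<^esub> G = pol_X P \<inter> \<Inter>G"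
  unfolding inf_def
  by (rule some_equality)
     (use stable_lattice_greatest[OF assms]
       partial_order.greatest_unique[OF partial_order_stable_lattice] in blast)+

lemma equiv_upow_eq: "equiv (I \<rightarrow>\<^sub>E A) (upow_eq I U A)"
proof (rule equivI)
  show "upow_eq I U A \<subseteq> (I \<rightarrow>\<^sub>E A) \<times> (I \<rightarrow>\<^sub>E A)" by (auto simp: upow_eq_def)
  show "refl_on (I \<rightarrow>\<^sub>E A) (upow_eq I U A)" by (auto simp: upow_eq_def refl_on_def)
  show "sym (upow_eq I U A)" by (auto simp: upow_eq_def sym_def elim: eventually_mono)
  show "trans (upow_eq I U A)"
    by (auto simp: upow_eq_def trans_def elim: eventually_elim2)
qed

lemma is_polarity_ultrapower: "is_polarity (ultrapower I U P)"
  by (auto simp: is_polarity_def ultrapower_def upow_set_def intro: quotientI)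

lemma ultrapower_rel_iff:
  assumes "f \<in> I \<rightarrow>\<^sub>E pol_X P" "g \<in> I \<rightarrow>\<^sub>E pol_Y P"
  shows "(upow_class I U (pol_X P) f, upow_class I U (pol_Y P) g) \<in> pol_R (ultrapower I U P)
           \<longleftrightarrow> (\<forall>\<^sub>F i in U. (f i, g i) \<in> pol_R P)" (is "?l \<longleftrightarrow> ?r")
proof
  assume ?l
  then obtain f' g' where fg: "f' \<in> I \<rightarrow>\<^sub>E pol_X P" "g' \<in> I \<rightarrow>\<^sub>E pol_Y P"
    "upow_class I U (pol_X P) f = upow_class I U (pol_X P) f'"
    "upow_class I U (pol_Y P) g = upow_class I U (pol_Y P) g'"
    "\<forall>\<^sub>F i in U. (f' i, g' i) \<in> pol_R P"
    by (auto simp: ultrapower_def)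
  have "\<forall>\<^sub>F i in U. f i = f' i" "\<forall>\<^sub>F i in U. g i = g' i"
    using eq_equiv_class[OF fg(3) equiv_upow_eq fg(1)] eq_equiv_class[OF fg(4) equiv_upow_eq fg(2)]
    by (auto simp: upow_eq_def)
  then show ?r using fg(5) by eventually_elim simp
next
  assume ?r
  then show ?l using assms by (auto simp: ultrapower_def)
qed


section \<open>Existence of canonical extensions\<close>

text \<open>
  Every bounded lattice has a canonical extension: the stable set lattice of the polarity of
  filters and ideals related by nonempty intersection.
\<close>

definition lattice_filters :: "('a, 'c) gorder_scheme \<Rightarrow> 'a set set" where
  "lattice_filters L = {F. F \<subseteq> carrier L \<and> \<top>\<^bsub>L\<^esub> \<in> F \<and>
     (\<forall>a\<in>F. \<forall>b\<in>carrier L. a \<sqsubseteq>\<^bsub>L\<^esub> b \<longrightarrow> b \<in> F) \<and> (\<forall>a\<in>F. \<forall>b\<in>F. a \<sqinter>\<^bsub>L\<^esub> b \<in> F)}"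

definition lattice_ideals :: "('a, 'c) gorder_scheme \<Rightarrow> 'a set set" where
  "lattice_ideals L = {J. J \<subseteq> carrier L \<and> \<bottom>\<^bsub>L\<^esub> \<in> J \<and>
     (\<forall>a\<in>J. \<forall>b\<in>carrier L. b \<sqsubseteq>\<^bsub>L\<^esub> a \<longrightarrow> b \<in> J) \<and> (\<forall>a\<in>J. \<forall>b\<in>J. a \<squnion>\<^bsub>L\<^esub> b \<in> J)}"

definition filter_ideal_polarity ::
  "('a, 'c) gorder_scheme \<Rightarrow> ('a set, 'a set) polarity" where
  "filter_ideal_polarity L =
     \<lparr>pol_X = lattice_filters L, pol_Y = lattice_ideals L,
      pol_R = {(F, J). F \<in> lattice_filters L \<and> J \<in> lattice_ideals L \<and> F \<inter> J \<noteq> {}}\<rparr>"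

context bounded_lattice
begin

lemma finite_inf_greatest:
  assumes "finite A" "A \<subseteq> carrier L"
  shows "greatest L (\<Sqinter>A) (Lower L A)"
proof (cases "A = {}")
  case True
  have "greatest L \<top> (Lower L {})" using top_greatest by (simp add: Lower_empty)
  then show ?thesis unfolding True inf_def by (rule someI)
qed (use assms finite_inf_greatest in blast)

lemma finite_sup_least:
  assumes "finite A" "A \<subseteq> carrier L"
  shows "least L (\<Squnion>A) (Upper L A)"
proof (cases "A = {}")
  case True
  have "least L \<bottom> (Upper L {})" using bottom_least by (simp add: Upper_empty)
  then show ?thesis unfolding True sup_def by (rule someI)
qed (use assms finite_sup_least in blast)

lemma finite_inf_facts:
  assumes "finite A" "A \<subseteq> carrier L"
  shows "\<Sqinter>A \<in> carrier L" "\<And>a. a \<in> A \<Longrightarrow> \<Sqinter>A \<sqsubseteq> a"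
    "\<And>z. z \<in> carrier L \<Longrightarrow> (\<And>a. a \<in> A \<Longrightarrow> z \<sqsubseteq> a) \<Longrightarrow> z \<sqsubseteq> \<Sqinter>A"
  using finite_inf_greatest[OF assms] assms unfolding greatest_def Lower_def by auto

lemma finite_sup_facts:
  assumes "finite A" "A \<subseteq> carrier L"
  shows "\<Squnion>A \<in> carrier L" "\<And>a. a \<in> A \<Longrightarrow> a \<sqsubseteq> \<Squnion>A"
    "\<And>z. z \<in> carrier L \<Longrightarrow> (\<And>a. a \<in> A \<Longrightarrow> a \<sqsubseteq> z) \<Longrightarrow> \<Squnion>A \<sqsubseteq> z"
  using finite_sup_least[OF assms] assms unfolding least_def Upper_def by auto

lemma principal_filter: "a \<in> carrier L \<Longrightarrow> {b \<in> carrier L. a \<sqsubseteq> b} \<in> lattice_filters L"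
  unfolding lattice_filters_def by (auto intro: le_trans meet_le)

lemma principal_ideal: "a \<in> carrier L \<Longrightarrow> {b \<in> carrier L. b \<sqsubseteq> a} \<in> lattice_ideals L"
  unfolding lattice_ideals_def by (auto intro: le_trans join_le)

lemma generated_filter:
  assumes "S \<subseteq> carrier L"
  shows "{b \<in> carrier L. \<exists>S'. finite S' \<and> S' \<subseteq> S \<and> \<Sqinter>S' \<sqsubseteq> b} \<in> lattice_filters L" (is "?G \<in> _")
  unfolding lattice_filters_def
proof (rule CollectI, intro conjI ballI impI)
  show "?G \<subseteq> carrier L" by blast
  have "\<Sqinter>{} \<sqsubseteq> \<top>"
    using top_higher[OF finite_inf_facts(1)[of "{}"]] by simp
  then show "\<top> \<in> ?G" using top_closed by blast
next
  fix a b assume a: "a \<in> ?G" and b: "b \<in> carrier L" and ab: "a \<sqsubseteq> b"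
  then obtain S' where S': "finite S'" "S' \<subseteq> S" "\<Sqinter>S' \<sqsubseteq> a" by blast
  have "S' \<subseteq> carrier L" using S' assms by blast
  with S'(1) have "\<Sqinter>S' \<in> carrier L" by (rule finite_inf_facts(1))
  then have "\<Sqinter>S' \<sqsubseteq> b" using le_trans[OF S'(3) ab] a b by simp
  then show "b \<in> ?G" using S' b by blast
next
  fix a b assume ab: "a \<in> ?G" "b \<in> ?G"
  then have mc: "a \<sqinter> b \<in> carrier L" by simp
  obtain A B where AB: "finite A" "A \<subseteq> S" "\<Sqinter>A \<sqsubseteq> a" "finite B" "B \<subseteq> S" "\<Sqinter>B \<sqsubseteq> b"
    using ab by blast
  have c: "finite (A \<union> B)" "A \<union> B \<subseteq> carrier L" "A \<subseteq> carrier L" "B \<subseteq> carrier L" "A \<union> B \<subseteq> S"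
    using AB assms by auto
  note cl = finite_inf_facts(1)[OF c(1,2)] finite_inf_facts(1)[OF AB(1) c(3)] finite_inf_facts(1)[OF AB(4) c(4)]
  have A: "\<Sqinter>(A \<union> B) \<sqsubseteq> \<Sqinter>A"
    by (rule finite_inf_facts(3)[OF AB(1) c(3) cl(1)], rule finite_inf_facts(2)[OF c(1,2)]) simp
  have B: "\<Sqinter>(A \<union> B) \<sqsubseteq> \<Sqinter>B"
    by (rule finite_inf_facts(3)[OF AB(4) c(4) cl(1)], rule finite_inf_facts(2)[OF c(1,2)]) simp
  have "\<Sqinter>(A \<union> B) \<sqsubseteq> a" "\<Sqinter>(A \<union> B) \<sqsubseteq> b"
    using le_trans[OF A AB(3)] le_trans[OF B AB(6)] cl ab by simp_all
  then have "\<Sqinter>(A \<union> B) \<sqsubseteq> a \<sqinter> b"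
    using meet_le cl(1) ab by simp
  then show "a \<sqinter> b \<in> ?G" using c(1,5) mc by blast
qed

lemma generated_ideal:
  assumes "S \<subseteq> carrier L"
  shows "{b \<in> carrier L. \<exists>S'. finite S' \<and> S' \<subseteq> S \<and> b \<sqsubseteq> \<Squnion>S'} \<in> lattice_ideals L" (is "?G \<in> _")
  unfolding lattice_ideals_def
proof (rule CollectI, intro conjI ballI impI)
  show "?G \<subseteq> carrier L" by blast
  have "\<bottom> \<sqsubseteq> \<Squnion>{}"
    using bottom_lower[OF finite_sup_facts(1)[of "{}"]] by simp
  then show "\<bottom> \<in> ?G" using bottom_closed by blast
next
  fix a b assume a: "a \<in> ?G" and b: "b \<in> carrier L" and ab: "b \<sqsubseteq> a"
  then obtain S' where S': "finite S'" "S' \<subseteq> S" "a \<sqsubseteq> \<Squnion>S'" by blast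
  have "S' \<subseteq> carrier L" using S' assms by blast
  with S'(1) have "\<Squnion>S' \<in> carrier L" by (rule finite_sup_facts(1))
  then have "b \<sqsubseteq> \<Squnion>S'" using le_trans[OF ab S'(3)] a b by simp
  then show "b \<in> ?G" using S' b by blast
next
  fix a b assume ab: "a \<in> ?G" "b \<in> ?G"
  then have mc: "a \<squnion> b \<in> carrier L" by simp
  obtain A B where AB: "finite A" "A \<subseteq> S" "a \<sqsubseteq> \<Squnion>A" "finite B" "B \<subseteq> S" "b \<sqsubseteq> \<Squnion>B"
    using ab by blast
  have c: "finite (A \<union> B)" "A \<union> B \<subseteq> carrier L" "A \<subseteq> carrier L" "B \<subseteq> carrier L" "A \<union> B \<subseteq> S"
    using AB assms by auto
  note cl = finite_sup_facts(1)[OF c(1,2)] finite_sup_facts(1)[OF AB(1) c(3)] finite_sup_facts(1)[OF AB(4) c(4)]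
  have A: "\<Squnion>A \<sqsubseteq> \<Squnion>(A \<union> B)"
    by (rule finite_sup_facts(3)[OF AB(1) c(3) cl(1)], rule finite_sup_facts(2)[OF c(1,2)]) simp
  have B: "\<Squnion>B \<sqsubseteq> \<Squnion>(A \<union> B)"
    by (rule finite_sup_facts(3)[OF AB(4) c(4) cl(1)], rule finite_sup_facts(2)[OF c(1,2)]) simp
  have "a \<sqsubseteq> \<Squnion>(A \<union> B)" "b \<sqsubseteq> \<Squnion>(A \<union> B)"
    using le_trans[OF AB(3) A] le_trans[OF AB(6) B] cl ab by simp_all
  then have "a \<squnion> b \<sqsubseteq> \<Squnion>(A \<union> B)"
    using join_le cl(1) ab by simp
  then show "a \<squnion> b \<in> ?G" using c(1,5) mc by blast
qed

theorem canonical_extension_exists: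
  "canonical_extension L (stable_lattice (filter_ideal_polarity L))
     (\<lambda>a. {F \<in> lattice_filters L. a \<in> F})"
proof -
  let ?Q = "filter_ideal_polarity L" and ?e = "\<lambda>a. {F \<in> lattice_filters L. a \<in> F}"
  let ?C = "stable_lattice ?Q"
  have X [simp]: "pol_X ?Q = lattice_filters L" and Y [simp]: "pol_Y ?Q = lattice_ideals L"
    by (auto simp: filter_ideal_polarity_def)
  have R: "(F, J) \<in> pol_R ?Q \<longleftrightarrow> F \<in> lattice_filters L \<and> J \<in> lattice_ideals L \<and> F \<inter> J \<noteq> {}" for F J
    by (auto simp: filter_ideal_polarity_def)
  have cl: "complete_lattice ?C" by (rule complete_lattice_stable_lattice)
  have rho_e: "rho ?Q (?e a) = {J \<in> lattice_ideals L. a \<in> J}" if a: "a \<in> carrier L" for a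
  proof -
    have "a \<in> J" if J: "J \<in> lattice_ideals L" and "\<forall>F \<in> ?e a. (F, J) \<in> pol_R ?Q" for J
    proof -
      have "{b \<in> carrier L. a \<sqsubseteq> b} \<inter> J \<noteq> {}" using that principal_filter[OF a] a R by blast
      then show ?thesis using J a by (auto simp: lattice_ideals_def)
    qed
    then show ?thesis by (auto simp: rho_def R)
  qed
  have lam_e: "lam ?Q {J \<in> lattice_ideals L. a \<in> J} = ?e a" if a: "a \<in> carrier L" for a
  proof -
    have "a \<in> F" if F: "F \<in> lattice_filters L"
      and "\<forall>J \<in> {J \<in> lattice_ideals L. a \<in> J}. (F, J) \<in> pol_R ?Q" for F
    proof -
      have "F \<inter> {b \<in> carrier L. b \<sqsubseteq> a} \<noteq> {}" using that principal_ideal[OF a] a R by blast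
      then show ?thesis using F a by (auto simp: lattice_filters_def)
    qed
    then show ?thesis by (auto simp: lam_def R)
  qed
  have e_in: "?e a \<in> carrier ?C" if "a \<in> carrier L" for a
    using stable_lam[of "{J \<in> lattice_ideals L. a \<in> J}" ?Q] lam_e[OF that]
    by (simp add: stable_lattice_def)
  have eS_in: "?e ` S \<subseteq> carrier ?C" if "S \<subseteq> carrier L" for S
    using e_in that by blast
  have inf_e: "\<Sqinter>\<^bsub>?C\<^esub> (?e ` S) = {F \<in> lattice_filters L. S \<subseteq> F}" if "S \<subseteq> carrier L" for S
    unfolding stable_lattice_inf[OF eS_in[OF that]] by auto
  have rho_T: "rho ?Q (\<Union> (?e ` T)) = {J \<in> lattice_ideals L. T \<subseteq> J}" if T: "T \<subseteq> carrier L" for T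
  proof -
    have "rho ?Q (\<Union> (?e ` T)) = {J \<in> lattice_ideals L. \<forall>a\<in>T. J \<in> rho ?Q (?e a)}"
      by (auto simp: rho_def)
    also have "\<dots> = {J \<in> lattice_ideals L. \<forall>a\<in>T. a \<in> J}"
    proof -
      have "J \<in> rho ?Q (?e a) \<longleftrightarrow> a \<in> J" if "J \<in> lattice_ideals L" "a \<in> T" for J a
        unfolding rho_e[OF subsetD[OF T that(2)]] using that by blast
      then show ?thesis by blast
    qed
    also have "\<dots> = {J \<in> lattice_ideals L. T \<subseteq> J}" by blast
    finally show ?thesis .
  qed
  have sup_e: "\<Squnion>\<^bsub>?C\<^esub> (?e ` T) = lam ?Q {J \<in> lattice_ideals L. T \<subseteq> J}" if "T \<subseteq> carrier L" for T
    unfolding stable_lattice_sup[OF eS_in[OF that]] rho_T[OF that] ..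
  have sup_J: "\<Squnion>\<^bsub>?C\<^esub> (?e ` J) = {F \<in> lattice_filters L. F \<inter> J \<noteq> {}}" if J: "J \<in> lattice_ideals L" for J
  proof -
    have "J \<subseteq> carrier L" using J by (auto simp: lattice_ideals_def)
    from sup_e[OF this] show ?thesis unfolding lam_def R X using J by blast
  qed
  have bC: "bounded_lattice ?C" by (rule bounded_lattice_of_complete[OF cl])
  interpret C: complete_lattice ?C by (rule cl)
  interpret C: bounded_lattice ?C by (rule bC)
  have inj: "inj_on ?e (carrier L)"
  proof (rule inj_onI)
    fix a b assume ab: "a \<in> carrier L" "b \<in> carrier L" and eq: "?e a = ?e b"
    have "{c \<in> carrier L. a \<sqsubseteq> c} \<in> ?e a" "{c \<in> carrier L. b \<sqsubseteq> c} \<in> ?e b"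
      using principal_filter ab by simp_all
    then have "{c \<in> carrier L. a \<sqsubseteq> c} \<in> ?e b" "{c \<in> carrier L. b \<sqsubseteq> c} \<in> ?e a"
      by (simp_all only: eq)
    then show "a = b" using ab by (auto intro: le_antisym)
  qed
  have jp: "?e (a \<squnion> b) = ?e a \<squnion>\<^bsub>?C\<^esub> ?e b" if ab: "a \<in> carrier L" "b \<in> carrier L" for a b
  proof -
    have "?e a \<squnion>\<^bsub>?C\<^esub> ?e b = lam ?Q {J \<in> lattice_ideals L. {a, b} \<subseteq> J}"
      using sup_e[of "{a, b}"] ab unfolding join_def by simp
    also have "{J \<in> lattice_ideals L. {a, b} \<subseteq> J} = {J \<in> lattice_ideals L. a \<squnion> b \<in> J}"
    proof (intro Collect_cong conj_cong refl iffI)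
      fix J assume J: "J \<in> lattice_ideals L"
      { assume "{a, b} \<subseteq> J" with J show "a \<squnion> b \<in> J" by (auto simp: lattice_ideals_def) }
      { assume "a \<squnion> b \<in> J"
        with J join_left[OF ab] join_right[OF ab] ab show "{a, b} \<subseteq> J"
          unfolding lattice_ideals_def by blast }
    qed
    finally show ?thesis using lam_e ab by simp
  qed
  have mp: "?e (a \<sqinter> b) = ?e a \<sqinter>\<^bsub>?C\<^esub> ?e b" if ab: "a \<in> carrier L" "b \<in> carrier L" for a b
  proof -
    have "?e a \<sqinter>\<^bsub>?C\<^esub> ?e b = {F \<in> lattice_filters L. {a, b} \<subseteq> F}"
      using inf_e[of "{a, b}"] ab unfolding meet_def by simp
    also have "\<dots> = ?e (a \<sqinter> b)"
    proof (intro Collect_cong conj_cong refl iffI)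
      fix F assume F: "F \<in> lattice_filters L"
      { assume "{a, b} \<subseteq> F" with F show "a \<sqinter> b \<in> F" by (auto simp: lattice_filters_def) }
      { assume "a \<sqinter> b \<in> F"
        with F meet_left[OF ab] meet_right[OF ab] ab show "{a, b} \<subseteq> F"
          unfolding lattice_filters_def by blast }
    qed
    finally show ?thesis by simp
  qed
  have bot: "?e \<bottom> = \<bottom>\<^bsub>?C\<^esub>"
  proof -
    have r: "rho ?Q (?e \<bottom>) = lattice_ideals L"
      using rho_e[OF bottom_closed] by (auto simp: lattice_ideals_def)
    have "?e \<bottom> \<subseteq> A" if "stable_set ?Q A" for A
    proof -
      have "?e \<bottom> = lam ?Q (lattice_ideals L)"
        using lam_e[OF bottom_closed] by (simp add: rho_e[OF bottom_closed, symmetric] r)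
      also have "\<dots> \<subseteq> lam ?Q (rho ?Q A)" by (auto simp: lam_def rho_def)
      finally show ?thesis using that by (simp add: stable_set_def)
    qed
    then have "?e \<bottom> \<subseteq> \<bottom>\<^bsub>?C\<^esub>" using C.bottom_closed by (simp add: stable_lattice_def)
    moreover have "\<bottom>\<^bsub>?C\<^esub> \<subseteq> ?e \<bottom>"
      using C.bottom_lower[OF e_in[OF bottom_closed]] by (simp add: stable_lattice_def)
    ultimately show ?thesis by simp
  qed
  have top: "?e \<top> = \<top>\<^bsub>?C\<^esub>"
  proof -
    have "?e \<top> = lattice_filters L" by (auto simp: lattice_filters_def)
    moreover have "\<top>\<^bsub>?C\<^esub> \<subseteq> lattice_filters L"
      using C.top_closed by (simp add: stable_lattice_def stable_set_def)
    moreover have "?e \<top> \<subseteq> \<top>\<^bsub>?C\<^esub>"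
      using C.top_higher[OF e_in[OF top_closed]] by (simp add: stable_lattice_def)
    ultimately show ?thesis by simp
  qed
  have emb: "lattice_embedding L ?C ?e"
    unfolding lattice_embedding_def join_pres_def meet_pres_def
    using bounded_lattice_axioms bC e_in inj jp mp bot top lattice_axioms C.lattice_axioms
    by (simp add: Pi_iff)
  have "dense_in L ?C ?e"
    unfolding dense_in_def
  proof (intro ballI conjI)
    fix Z assume Z: "Z \<in> carrier ?C"
    then have Zs: "Z \<subseteq> lattice_filters L" "lam ?Q (rho ?Q Z) = Z"
      by (auto simp: stable_lattice_def stable_set_def)
    have Zc: "F \<subseteq> carrier L" if "F \<in> Z" for F
      using Zs that by (auto simp: lattice_filters_def)
    have up: "G \<in> Z" if "F \<in> Z" "F \<subseteq> G" "G \<in> lattice_filters L" for F G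
    proof -
      have "G \<inter> J \<noteq> {}" "J \<in> lattice_ideals L" if "J \<in> rho ?Q Z" for J
        using that \<open>F \<in> Z\<close> \<open>F \<subseteq> G\<close> unfolding rho_def R by blast+
      then have "G \<in> lam ?Q (rho ?Q Z)"
        using that(3) unfolding lam_def R X by blast
      then show ?thesis using Zs by simp
    qed
    show "\<exists>\<S> \<subseteq> Pow (carrier L). Z = \<Squnion>\<^bsub>?C\<^esub> {\<Sqinter>\<^bsub>?C\<^esub> (?e ` S) | S. S \<in> \<S>}"
    proof (intro exI[of _ Z] conjI)
      let ?G = "{\<Sqinter>\<^bsub>?C\<^esub> (?e ` S) | S. S \<in> Z}"
      have img: "?G = (\<lambda>S. {F \<in> lattice_filters L. S \<subseteq> F}) ` Z"
        unfolding Setcompr_eq_image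
        by (intro image_cong refl inf_e Zc) simp
      have sub: "?G \<subseteq> carrier ?C"
        using C.inf_closed[OF eS_in[OF Zc]] by blast
      have "\<Union>?G = Z"
        unfolding img using up Zs(1) by blast
      then show "Z = \<Squnion>\<^bsub>?C\<^esub> ?G"
        by (simp only: stable_lattice_sup[OF sub] Zs(2))
    qed (use Zc in auto)
    show "\<exists>\<T> \<subseteq> Pow (carrier L). Z = \<Sqinter>\<^bsub>?C\<^esub> {\<Squnion>\<^bsub>?C\<^esub> (?e ` T) | T. T \<in> \<T>}"
    proof (intro exI[of _ "rho ?Q Z"] conjI)
      let ?G = "{\<Squnion>\<^bsub>?C\<^esub> (?e ` T) | T. T \<in> rho ?Q Z}"
      have c: "J \<in> lattice_ideals L" "J \<subseteq> carrier L" if "J \<in> rho ?Q Z" for J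
        using that by (auto simp: rho_def lattice_ideals_def)
      have img: "?G = (\<lambda>J. {F \<in> lattice_filters L. F \<inter> J \<noteq> {}}) ` rho ?Q Z"
        unfolding Setcompr_eq_image
        by (intro image_cong refl sup_J c(1)) simp
      have sub: "?G \<subseteq> carrier ?C"
        using C.sup_closed[OF eS_in[OF c(2)]] by blast
      have "pol_X ?Q \<inter> \<Inter>?G = lam ?Q (rho ?Q Z)"
        unfolding img lam_def R X using c(1) by blast
      then show "Z = \<Sqinter>\<^bsub>?C\<^esub> ?G"
        by (simp only: stable_lattice_inf[OF sub] Zs(2))
      show "rho ?Q Z \<subseteq> Pow (carrier L)" using c by auto
    qed
  qed
  moreover have "compact_in L ?C ?e"
    unfolding compact_in_def
  proof (intro allI impI, elim conjE)
    fix S T assume ST: "S \<subseteq> carrier L" "T \<subseteq> carrier L"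
      and le: "\<Sqinter>\<^bsub>?C\<^esub> (?e ` S) \<sqsubseteq>\<^bsub>?C\<^esub> \<Squnion>\<^bsub>?C\<^esub> (?e ` T)"
    have sub: "{F \<in> lattice_filters L. S \<subseteq> F} \<subseteq> lam ?Q {J \<in> lattice_ideals L. T \<subseteq> J}"
      using le unfolding inf_e[OF ST(1)] sup_e[OF ST(2)] by (simp add: stable_lattice_def)
    let ?F = "{b \<in> carrier L. \<exists>S'. finite S' \<and> S' \<subseteq> S \<and> \<Sqinter>S' \<sqsubseteq> b}"
    let ?J = "{b \<in> carrier L. \<exists>S'. finite S' \<and> S' \<subseteq> T \<and> b \<sqsubseteq> \<Squnion>S'}"
    have SF: "S \<subseteq> ?F"
    proof
      fix a assume a: "a \<in> S"
      then have "\<Sqinter>{a} \<sqsubseteq> a" using ST finite_inf_facts(2)[of "{a}" a] by auto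
      then show "a \<in> ?F" using a ST by (auto intro!: exI[of _ "{a}"])
    qed
    have TJ: "T \<subseteq> ?J"
    proof
      fix a assume a: "a \<in> T"
      then have "a \<sqsubseteq> \<Squnion>{a}" using ST finite_sup_facts(2)[of "{a}" a] by auto
      then show "a \<in> ?J" using a ST by (auto intro!: exI[of _ "{a}"])
    qed
    have F: "?F \<in> {F \<in> lattice_filters L. S \<subseteq> F}"
      using SF generated_filter[OF ST(1)] by (intro CollectI conjI)
    have J: "?J \<in> {J \<in> lattice_ideals L. T \<subseteq> J}"
      using TJ generated_ideal[OF ST(2)] by (intro CollectI conjI)
    define F' J' where "F' = ?F" and "J' = ?J"
    have "F' \<in> lam ?Q {J \<in> lattice_ideals L. T \<subseteq> J}" "J' \<in> {J \<in> lattice_ideals L. T \<subseteq> J}"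
      using subsetD[OF sub F] J unfolding F'_def J'_def .
    then have "F' \<inter> J' \<noteq> {}" unfolding lam_def R by blast
    then have "?F \<inter> ?J \<noteq> {}" unfolding F'_def J'_def .
    then obtain b S' T' where b: "b \<in> carrier L" "finite S'" "S' \<subseteq> S" "\<Sqinter>S' \<sqsubseteq> b"
      "finite T'" "T' \<subseteq> T" "b \<sqsubseteq> \<Squnion>T'"
      by blast
    have "\<Sqinter>S' \<sqsubseteq> \<Squnion>T'"
      using le_trans[OF b(4) b(7)] b ST finite_inf_facts(1)[of S'] finite_sup_facts(1)[of T'] by auto
    then show "\<exists>S' T'. finite S' \<and> S' \<subseteq> S \<and> finite T' \<and> T' \<subseteq> T \<and> \<Sqinter>S' \<sqsubseteq> \<Squnion>T'"
      using b(2,3,5,6) by blast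
  qed
  ultimately show ?thesis using cl emb unfolding canonical_extension_def by blast
qed

end

end

theory Submission
  imports Defs
begin

text \<open>
  Let \<open>L = P\<^sup>+\<close>, and let \<open>U\<close> be an ultrafilter so good that any family of internal conditions
  indexed by subsets of \<open>X\<close> is realised in \<open>P\<^sup>U\<close> as soon as its finite subfamilies are. A point \<open>f\<close> of
  \<open>X\<^sup>U\<close> determines the filter of those \<open>A\<close> in \<open>L\<close> with \<open>f \<in> A\<^sup>U\<close>, hence the meet \<open>\<phi> f\<close> of their
  images in the canonical extension; a point \<open>g\<close> of \<open>Y\<^sup>U\<close> determines the ideal of those \<open>A\<close> with
  \<open>g \<in> (\<rho> A)\<^sup>U\<close>, hence a join \<open>\<psi> g\<close>. For \<open>z\<close> in the canonical extension,
  \<open>{f. \<phi> f \<le> z}\<close> and \<open>{g. z \<le> \<psi> g}\<close> are \<open>\<lambda>\<close> and \<open>\<rho>\<close> of each other: compactness shows that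
  \<open>\<phi> f \<le> z \<le> \<psi> g\<close> implies \<open>f R\<^sup>U g\<close>, and density with saturation provides unrelated witnesses
  otherwise. So \<open>z \<mapsto> {f. \<phi> f \<le> z}\<close> is the embedding.

  The good ultrafilter is obtained by Kunen's method: starting from as many independent functions as
  there are antitone families \<open>p\<close> of sets, one extends a family of sets transfinitely, treating one
  \<open>p\<close> and using up only finitely many of the functions at each step.
\<close>

section \<open>Good ultrafilters\<close>

text \<open>Independence modulo the filter generated by \<open>E\<close>. For \<open>K = {}\<close>
  it is the finite intersection property of \<open>E\<close>; for \<open>E = {}\<close> it lets
  finitely many of the functions take arbitrary values at a common point.\<close>

definition independent_over :: "('k \<Rightarrow> 'i \<Rightarrow> 'v) \<Rightarrow> 'k set \<Rightarrow> 'i set set \<Rightarrow> bool" where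
  "independent_over g K E \<longleftrightarrow>
     (\<forall>D N v. finite D \<and> D \<subseteq> E \<and> finite N \<and> N \<subseteq> K \<longrightarrow> (\<exists>i\<in>\<Inter>D. \<forall>k\<in>N. g k i = v k))"

lemma independent_overD:
  assumes "independent_over g K E" "finite D" "D \<subseteq> E" "finite N" "N \<subseteq> K"
  obtains i where "i \<in> \<Inter>D" "\<And>k. k \<in> N \<Longrightarrow> g k i = v k"
  using assms unfolding independent_over_def by meson

text \<open>Lists stand for finite sets: lists with the same elements receive the same
  value.\<close>

definition antitone_family :: "('l list \<Rightarrow> 'i set) \<Rightarrow> bool" where
  "antitone_family p \<longleftrightarrow> (\<forall>S T. set S \<subseteq> set T \<longrightarrow> p T \<subseteq> p S)"

lemma antitone_family_concat:
  "antitone_family p \<Longrightarrow> S \<in> set Ss \<Longrightarrow> p (concat Ss) \<subseteq> p S"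
  unfolding antitone_family_def by (metis UN_upper set_concat)

text \<open>
  In the second case no proper filter containing \<open>E\<close> contains all values of \<open>p\<close>, so goodness
  demands nothing for \<open>p\<close>.
\<close>

definition settled :: "('l list \<Rightarrow> 'i set) \<Rightarrow> 'i set set \<Rightarrow> bool" where
  "settled p E \<longleftrightarrow>
     (\<exists>h. \<forall>S. {i \<in> p (h i). set S \<subseteq> set (h i)} \<in> E) \<or>
     (\<exists>D S. finite D \<and> D \<subseteq> E \<and> \<Inter>D \<inter> p S = {})"

lemma settled_mono: "settled p E \<Longrightarrow> E \<subseteq> E' \<Longrightarrow> settled p E'"
  unfolding settled_def by (meson order_trans subsetD)

text \<open>If the values of \<open>p\<close> can be added without losing independence, one function
  \<open>g k\<close> is spent to choose the refinement. Otherwise some finite pattern of values of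
  the functions clashes with finitely many sets from \<open>E\<close> and \<open>range p\<close>;
  imposing that pattern spends only the functions in it and rules \<open>p\<close> out.\<close>

lemma settle_step:
  fixes g :: "'k \<Rightarrow> 'i \<Rightarrow> 'l list" and p :: "'l list \<Rightarrow> 'i set"
  assumes ind: "independent_over g K E" and p: "antitone_family p" and k: "k \<in> K"
  shows "\<exists>E' H. finite H \<and> independent_over g (K - H) (E \<union> E') \<and> settled p (E \<union> E')"
proof (cases "independent_over g K (E \<union> range p)")
  case True
  define q where "q S = {i \<in> p (g k i). set S \<subseteq> set (g k i)}" for S
  have "independent_over g (K - {k}) (E \<union> range q)"
    unfolding independent_over_def
  proof (intro allI impI, elim conjE)
    fix D N and v :: "'k \<Rightarrow> 'l list"
    assume D: "finite D" "D \<subseteq> E \<union> range q" and N: "finite N" "N \<subseteq> K - {k}"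
    have "finite (D - E)" "D - E \<subseteq> range q" using D by auto
    then obtain Ss where "finite Ss" "D - E = q ` Ss" by (meson finite_subset_image)
    then obtain Ls where Ls: "D - E = q ` set Ls" by (metis finite_list)
    let ?S = "concat Ls"
    \<comment> \<open>Giving \<open>g k\<close> the value \<open>concat Ls\<close> puts
      \<open>i\<close> into \<open>q S\<close> for all lists \<open>S\<close> in \<open>Ls\<close>
      at once.\<close>
    obtain i where i: "i \<in> \<Inter>(insert (p ?S) (D \<inter> E))"
      "\<And>j. j \<in> insert k N \<Longrightarrow> g j i = (v(k := ?S)) j"
      by (rule independent_overD[OF True, of "insert (p ?S) (D \<inter> E)" "insert k N" "v(k := ?S)"])
        (use D N k in auto)
    have gk: "g k i = ?S" using i(2)[of k] by simp
    have "i \<in> q S" if "S \<in> set Ls" for S using i(1) that antitone_family_concat[OF p that] by (auto simp: q_def gk)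
    then have "i \<in> \<Inter>D" using i(1) Ls by blast
    moreover have "\<forall>j\<in>N. g j i = v j" using i(2) N by auto
    ultimately show "\<exists>i\<in>\<Inter>D. \<forall>j\<in>N. g j i = v j" by blast
  qed
  moreover have "settled p (E \<union> range q)" unfolding settled_def q_def by blast
  ultimately show ?thesis by blast
next
  case False
  then obtain D N v where D: "finite D" "D \<subseteq> E \<union> range p" and N: "finite N" "N \<subseteq> K"
    and no: "\<not> (\<exists>i\<in>\<Inter>D. \<forall>k\<in>N. g k i = v k)"
    unfolding independent_over_def by blast
  \<comment> \<open>These sets freeze the functions in \<open>N\<close> at the clashing values
    \<open>v\<close>. The others stay free because \<open>v\<close> on \<open>N\<close> can be
    combined with any \<open>v1\<close> outside \<open>N\<close>.\<close>
  define E' where "E' = (\<lambda>k. {i. g k i = v k}) ` N"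
  have "independent_over g (K - N) (E \<union> E')"
    unfolding independent_over_def
  proof (intro allI impI, elim conjE)
    fix D1 N1 and v1 :: "'k \<Rightarrow> 'l list"
    assume D1: "finite D1" "D1 \<subseteq> E \<union> E'" and N1: "finite N1" "N1 \<subseteq> K - N"
    let ?v = "\<lambda>k. if k \<in> N then v k else v1 k"
    obtain i where i: "i \<in> \<Inter>(D1 \<inter> E)" "\<And>j. j \<in> N \<union> N1 \<Longrightarrow> g j i = ?v j"
      by (rule independent_overD[OF ind, of "D1 \<inter> E" "N \<union> N1" ?v]) (use D1 N N1 in auto)
    have "i \<in> \<Inter>E'" using i(2) unfolding E'_def by auto
    then have "i \<in> \<Inter>D1" using i(1) D1(2) by blast
    moreover have "\<forall>j\<in>N1. g j i = v1 j" using i(2) N1 by auto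
    ultimately show "\<exists>i\<in>\<Inter>D1. \<forall>j\<in>N1. g j i = v1 j" by blast
  qed
  moreover have "settled p (E \<union> E')"
  proof -
    have "finite (D - E)" "D - E \<subseteq> range p" using D by auto
    then obtain Ss where "finite Ss" "D - E = p ` Ss" by (meson finite_subset_image)
    then obtain Ls where Ls: "D - E = p ` set Ls" by (metis finite_list)
    \<comment> \<open>The values of \<open>p\<close> in \<open>D - E\<close> all contain
      \<open>p (concat Ls)\<close>, so this single value already clashes with
      \<open>?D\<close>.\<close>
    let ?D = "(D \<inter> E) \<union> E'"
    have "\<Inter>?D \<inter> p (concat Ls) = {}"
    proof (rule ccontr)
      assume "\<Inter>?D \<inter> p (concat Ls) \<noteq> {}"
      then obtain i where i: "i \<in> \<Inter>?D" "i \<in> p (concat Ls)" by blast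
      have "i \<in> p S" if "S \<in> set Ls" for S using antitone_family_concat[OF p that] i(2) by blast
      then have "i \<in> \<Inter>D" using i(1) Ls by blast
      moreover have "\<forall>k\<in>N. g k i = v k" using i(1) unfolding E'_def by auto
      ultimately show False using no by blast
    qed
    moreover have "finite ?D" "?D \<subseteq> E \<union> E'" using D N unfolding E'_def by auto
    ultimately show ?thesis unfolding settled_def by blast
  qed
  ultimately show ?thesis using N(1) by blast
qed

section \<open>The transfinite extension\<close>

lemma finite_subset_UN_chain:
  assumes "finite D" "D \<subseteq> (\<Union>s\<in>A. F s)" "D \<noteq> {}"
    and chain: "\<And>s t. s \<in> A \<Longrightarrow> t \<in> A \<Longrightarrow> F s \<subseteq> F t \<or> F t \<subseteq> F s"
  obtains s where "s \<in> A" "D \<subseteq> F s"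
proof -
  have "subset.chain UNIV (F ` A)" using chain by (auto simp: subset_chain_def)
  moreover have "F ` A \<noteq> {}" using assms(2,3) by auto
  ultimately obtain B where "B \<in> F ` A" "D \<subseteq> B"
    using finite_subset_Union_chain[OF assms(1,2)] by metis
  then show ?thesis using that by blast
qed

text \<open>Independence concerns only finite subsets of the family, and a nonempty one lies in a
  single stage of the chain; \<open>base\<close> serves the empty one, also when \<open>A\<close> is
  empty.\<close>

lemma independent_over_UN_chain:
  assumes step: "\<And>s. s \<in> A \<Longrightarrow> independent_over g (K s) (F s)" "\<And>s. s \<in> A \<Longrightarrow> K' \<subseteq> K s"
    and base: "independent_over g K' {}"
    and chain: "\<And>s t. s \<in> A \<Longrightarrow> t \<in> A \<Longrightarrow> F s \<subseteq> F t \<or> F t \<subseteq> F s"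
  shows "independent_over g K' (\<Union>s\<in>A. F s)"
  unfolding independent_over_def
proof (intro allI impI, elim conjE)
  fix D N v assume D: "finite D" "D \<subseteq> (\<Union>s\<in>A. F s)" and N: "finite N" "N \<subseteq> K'"
  show "\<exists>i\<in>\<Inter>D. \<forall>k\<in>N. g k i = v k"
  proof (cases "D = {}")
    case True
    then show ?thesis using base N unfolding independent_over_def by blast
  next
    case False
    then obtain s where s: "s \<in> A" "D \<subseteq> F s" using finite_subset_UN_chain[OF D _ chain] by metis
    have "N \<subseteq> K s" using step(2)[OF s(1)] N by blast
    then show ?thesis using step(1)[OF s(1)] s(2) D(1) N(1) unfolding independent_over_def by blast
  qed
qed

text \<open>A proper initial segment of a cardinal well-order is smaller than the whole, so finite
  sets indexed by it cannot exhaust the infinite type. Hence every stage of the recursion finds an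
  unspent function.\<close>

lemma UN_finite_underS_ne_UNIV:
  includes cardinal_syntax
  fixes H :: "'k \<Rightarrow> 'k set"
  assumes inf: "infinite (UNIV :: 'k set)" and fin: "\<And>s. s \<in> underS (card_of (UNIV :: 'k set)) t \<Longrightarrow> finite (H s)"
  shows "(\<Union>s\<in>underS (card_of (UNIV :: 'k set)) t. H s) \<noteq> UNIV"
proof
  let ?A = "underS (card_of (UNIV :: 'k set)) t"
  assume eq: "(\<Union>s\<in>?A. H s) = UNIV"
  have lt: "card_of ?A <o card_of (UNIV :: 'k set)"
    by (rule card_of_underS) (simp_all add: card_of_card_order_on Field_card_of)
  have A: "infinite ?A" using eq fin inf by (metis finite_UN_I)
  have "\<forall>s\<in>?A. card_of (H s) \<le>o card_of ?A"
    using fin A by (meson card_of_ordLeq_finite card_of_Well_order ordLeq_total)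
  then have "card_of (\<Union>s\<in>?A. H s) \<le>o card_of ?A"
    by (intro card_of_UNION_ordLeq_infinite[OF A]) (simp_all add: card_of_refl ordIso_imp_ordLeq)
  then show False using lt eq by (metis not_ordLess_ordLeq)
qed

text \<open>Recursion along the cardinal well-order of \<open>'k\<close>: stage \<open>t\<close>
  treats \<open>dec t\<close>, and surjectivity of \<open>dec\<close> gives every family its
  turn.\<close>

lemma settled_extension:
  fixes g :: "'k \<Rightarrow> 'i \<Rightarrow> 'l list" and dec :: "'k \<Rightarrow> 'l list \<Rightarrow> 'i set"
  assumes inf: "infinite (UNIV :: 'k set)" and ind: "independent_over g UNIV {}"
    and surj: "surj dec"
  obtains E where "independent_over g {} E" "\<And>p :: 'l list \<Rightarrow> 'i set. antitone_family p \<Longrightarrow> settled p E"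
proof -
  let ?r = "card_of (UNIV :: 'k set)"
  have F: "Field ?r = UNIV" by (rule Field_card_of)
  have wo: "Well_order ?r" by (rule card_of_Well_order)
  have wf: "wf (?r - Id)" using wo unfolding well_order_on_def by blast
  have lin: "Total ?r" "trans ?r" "antisym ?r"
    using wo unfolding well_order_on_def linear_order_on_def partial_order_on_def preorder_on_def F
    by (simp_all)
  have us: "underS ?r t = {s. (s, t) \<in> ?r - Id}" for t by (auto simp: underS_def)
  have tr: "underS ?r s \<subseteq> underS ?r t" if "s \<in> underS ?r t" for s t
    using that lin(2,3) unfolding underS_def trans_def antisym_def by blast
  \<comment> \<open>\<open>P f t x\<close> says that, after the earlier choices \<open>f\<close>,
    the pair \<open>x\<close> of new sets and newly spent functions is admissible at stage
    \<open>t\<close>.\<close>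
  define P where "P f t x \<longleftrightarrow> finite (snd x) \<and>
     independent_over g (UNIV - ((\<Union>s\<in>underS ?r t. snd (f s)) \<union> snd x)) ((\<Union>s\<in>underS ?r t. fst (f s)) \<union> fst x) \<and>
     (antitone_family (dec t) \<longrightarrow> settled (dec t) ((\<Union>s\<in>underS ?r t. fst (f s)) \<union> fst x))"
    for f :: "'k \<Rightarrow> 'i set set \<times> 'k set" and t x
  define EE where "EE f s = (\<Union>u\<in>underS ?r s. fst (f u)) \<union> fst (f s)" for f :: "'k \<Rightarrow> 'i set set \<times> 'k set" and s
  define HH where "HH f s = (\<Union>u\<in>underS ?r s. snd (f u)) \<union> snd (f s)" for f :: "'k \<Rightarrow> 'i set set \<times> 'k set" and s
  have EE_mono: "EE f s \<subseteq> EE f t" if "s \<in> underS ?r t" for f s t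
    using tr[OF that] that unfolding EE_def by blast
  have chain: "EE f s \<subseteq> EE f t \<or> EE f t \<subseteq> EE f s" for f s t
  proof (cases "s = t")
    case False
    then have "s \<in> underS ?r t \<or> t \<in> underS ?r s"
      using lin(1) F unfolding total_on_def underS_def by auto
    then show ?thesis using EE_mono by blast
  qed simp
  \<comment> \<open>The increments \<open>fst (f s)\<close> need not be nested; the accumulated
    families \<open>EE f s\<close> have the same union and form a chain.\<close>
  have UE: "(\<Union>s\<in>underS ?r t. fst (f s)) = (\<Union>s\<in>underS ?r t. EE f s)" for f t
    unfolding EE_def using tr by blast
  have UH: "s \<in> underS ?r t \<Longrightarrow> HH f s \<subseteq> (\<Union>s\<in>underS ?r t. snd (f s))" for f s t
    unfolding HH_def using tr by blast
  have base: "independent_over g K {}" for K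
    using ind unfolding independent_over_def by blast
  have PE: "P f s (f s) \<longleftrightarrow> finite (snd (f s)) \<and> independent_over g (UNIV - HH f s) (EE f s) \<and>
     (antitone_family (dec s) \<longrightarrow> settled (dec s) (EE f s))" for f s
    unfolding P_def EE_def HH_def ..
  have "\<exists>f. \<forall>x. P f x (f x)"
  proof (rule dependent_wf_choice[OF wf])
    fix f h :: "'k \<Rightarrow> 'i set set \<times> 'k set" and t x
    assume "\<And>z. (z, t) \<in> ?r - Id \<Longrightarrow> f z = h z"
    then have "(\<Union>s\<in>underS ?r t. snd (f s)) = (\<Union>s\<in>underS ?r t. snd (h s))"
      "(\<Union>s\<in>underS ?r t. fst (f s)) = (\<Union>s\<in>underS ?r t. fst (h s))"
      unfolding us by auto
    then show "P f t x = P h t x" unfolding P_def by simp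
  next
    fix t f assume IH: "\<And>y. (y, t) \<in> ?r - Id \<Longrightarrow> P f y (f y)"
    let ?E = "\<Union>s\<in>underS ?r t. fst (f s)" and ?H = "\<Union>s\<in>underS ?r t. snd (f s)"
    have ind_t: "independent_over g (UNIV - ?H) ?E"
      unfolding UE
    proof (rule independent_over_UN_chain[where K = "\<lambda>s. UNIV - HH f s"])
      fix s assume s: "s \<in> underS ?r t"
      show "independent_over g (UNIV - HH f s) (EE f s)" using IH s unfolding us PE by blast
      show "UNIV - ?H \<subseteq> UNIV - HH f s" using UH[OF s] by blast
    qed (rule base chain)+
    show "\<exists>x. P f t x"
    proof (cases "antitone_family (dec t)")
      case True
      have "?H \<noteq> UNIV"
        by (rule UN_finite_underS_ne_UNIV[OF inf]) (use IH in \<open>unfold us PE, blast\<close>)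
      then obtain k where "k \<in> UNIV - ?H" by blast
      from settle_step[OF ind_t True this] obtain E' H where
        "finite H" "independent_over g (UNIV - ?H - H) (?E \<union> E')" "settled (dec t) (?E \<union> E')" by blast
      then have "P f t (E', H)" unfolding P_def by (simp add: Diff_eq Int_assoc)
      then show ?thesis ..
    next
      case False
      then have "P f t ({}, {})" using ind_t unfolding P_def by simp
      then show ?thesis ..
    qed
  qed
  then obtain f where f: "\<And>x. P f x (f x)" by blast
  show ?thesis
  proof
    show "independent_over g {} (\<Union>s. EE f s)"
      by (rule independent_over_UN_chain[where K = "\<lambda>s. UNIV - HH f s"])
        (use f PE base chain in auto)
    fix p :: "'l list \<Rightarrow> 'i set" assume p: "antitone_family p"
    obtain t where "p = dec t" using surj by (metis surjD)
    then have "settled p (EE f t)" using f[of t] p unfolding PE by blast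
    then show "settled p (\<Union>s. EE f s)" by (rule settled_mono) blast
  qed
qed

section \<open>Ultrafilters and goodness\<close>

text \<open>Smaller filters have more members, so Zorn's lemma is applied to find a minimal filter
  other than \<open>bot\<close>. If the complement of \<open>Q\<close> is not large, restricting
  \<open>U\<close> to \<open>Q\<close> leaves it proper, so minimality makes \<open>Q\<close>
  large.\<close>

lemma ultrafilter_below:
  fixes F :: "'i filter"
  assumes "F \<noteq> bot"
  obtains U where "U \<le> F" "ultrafilter_on UNIV U"
proof -
  let ?A = "{G. G \<noteq> bot \<and> G \<le> F}"
  have "\<exists>m\<in>?A. \<forall>a\<in>?A. a \<le> m \<longrightarrow> a = m"
  proof (rule predicate_Zorn)
    show "partial_order_on ?A (relation_of (\<lambda>x y. y \<le> x) ?A)"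
      by (rule partial_order_on_relation_ofI) auto
    fix C assume C: "C \<in> Chains (relation_of (\<lambda>x y. y \<le> x) ?A)"
    show "\<exists>u\<in>?A. \<forall>a\<in>C. u \<le> a"
    proof (cases "C = {}")
      case True
      then show ?thesis using assms by blast
    next
      case False
      have sub: "C \<subseteq> ?A" and ch: "\<And>G H. G \<in> C \<Longrightarrow> H \<in> C \<Longrightarrow> G \<le> H \<or> H \<le> G"
        using C unfolding Chains_def relation_of_def by blast+
      have "eventually P (Inf C) \<longleftrightarrow> (\<exists>b\<in>C. eventually P b)" for P
        by (rule eventually_Inf_base[OF False]) (metis ch inf.absorb1 inf.absorb2 order_refl)
      from this[of "\<lambda>_. False"] have "Inf C \<noteq> bot" using sub
        by (auto simp: trivial_limit_def)
      moreover have "Inf C \<le> F" using False sub by (metis (no_types, lifting) Inf_lower2 all_not_in_conv mem_Collect_eq subsetD)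
      ultimately show ?thesis by (auto intro: Inf_lower)
    qed
  qed
  then obtain U where U: "U \<noteq> bot" "U \<le> F" and min: "\<And>G. G \<noteq> bot \<Longrightarrow> G \<le> U \<Longrightarrow> G = U"
    by (auto intro: order_trans)
  have "eventually Q U \<or> eventually (\<lambda>i. \<not> Q i) U" for Q
  proof (rule disjCI)
    assume n: "\<not> eventually (\<lambda>i. \<not> Q i) U"
    let ?G = "inf U (principal {i. Q i})"
    have ev: "eventually P ?G \<longleftrightarrow> (\<forall>\<^sub>F i in U. Q i \<longrightarrow> P i)" for P
      by (simp add: eventually_inf_principal)
    have "?G \<noteq> bot" using n ev[of "\<lambda>_. False"] by (auto simp: trivial_limit_def)
    then have "?G = U" using min by simp
    then show "eventually Q U" using ev[of Q] by simp
  qed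
  then show ?thesis using that U unfolding ultrafilter_on_def by simp
qed

text \<open>
  Goodness of an ultrafilter for a set of parameters of the size of \<open>'l\<close>. The function \<open>h\<close>
  encodes the multiplicative refinement of \<open>p\<close> that sends \<open>S\<close> to \<open>{i \<in> p (h i). S \<subseteq> h i}\<close>.
\<close>

definition good_filter :: "'l itself \<Rightarrow> 'i filter \<Rightarrow> bool" where
  "good_filter _ U \<longleftrightarrow> (\<forall>p :: 'l list \<Rightarrow> 'i set. antitone_family p \<and> (\<forall>S. \<forall>\<^sub>F i in U. i \<in> p S) \<longrightarrow>
     (\<exists>h. \<forall>S. \<forall>\<^sub>F i in U. i \<in> p (h i) \<and> set S \<subseteq> set (h i)))"

text \<open>Any ultrafilter containing \<open>E\<close> will do. When all values of \<open>p\<close>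
  are large, the second alternative of \<open>settled\<close> would make the empty set large, and
  the first is the refinement that goodness asks for.\<close>

lemma good_ultrafilter_from_independent:
  fixes g :: "'k \<Rightarrow> 'i \<Rightarrow> 'l list" and dec :: "'k \<Rightarrow> 'l list \<Rightarrow> 'i set"
  assumes "infinite (UNIV :: 'k set)" "independent_over g UNIV {}" "surj dec"
  obtains U :: "'i filter" where "ultrafilter_on UNIV U" "good_filter TYPE('l) U"
proof -
  obtain E where E: "independent_over g {} E" and s: "\<And>p :: 'l list \<Rightarrow> 'i set. antitone_family p \<Longrightarrow> settled p E"
    using settled_extension[OF assms] by blast
  let ?F = "INF A\<in>E. principal A"
  have "?F \<noteq> bot"
  proof
    assume "?F = bot"
    then have "eventually (\<lambda>_. False) ?F" by (simp add: trivial_limit_def)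
    from iffD1[OF eventually_INF this] obtain D
      where D: "D \<subseteq> E" "finite D" "eventually (\<lambda>_. False) (INF A\<in>D. principal A)"
      by blast
    then have "\<Inter>D = {}"
      unfolding INF_principal_finite[OF D(2)] by (simp add: eventually_principal) blast
    then show False using independent_overD[OF E D(2,1), of "{}" undefined] by auto
  qed
  then obtain U where U: "U \<le> ?F" "ultrafilter_on UNIV U" by (rule ultrafilter_below)
  have EU: "\<forall>\<^sub>F i in U. i \<in> A" if "A \<in> E" for A
  proof -
    have "U \<le> principal A" using U(1) that by (meson INF_lower order_trans)
    then show ?thesis by (simp add: le_principal)
  qed
  have "good_filter TYPE('l) U"
    unfolding good_filter_def
  proof (intro allI impI, elim conjE)
    fix p :: "'l list \<Rightarrow> 'i set" assume p: "antitone_family p" "\<forall>S. \<forall>\<^sub>F i in U. i \<in> p S"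
    have "\<Inter>D \<inter> p S \<noteq> {}" if "finite D" "D \<subseteq> E" for D S
    proof -
      have "\<forall>\<^sub>F i in U. \<forall>A\<in>D. i \<in> A" using that EU
        by (intro eventually_ball_finite) blast+
      then have "\<forall>\<^sub>F i in U. i \<in> \<Inter>D \<inter> p S" using p(2)[rule_format, of S] by eventually_elim blast
      then show ?thesis using U(2) eventually_happens' unfolding ultrafilter_on_def by blast
    qed
    with s[OF p(1)] obtain h where "\<And>S. {i \<in> p (h i). set S \<subseteq> set (h i)} \<in> E"
      unfolding settled_def by blast
    from EU[OF this] show "\<exists>h. \<forall>S. \<forall>\<^sub>F i in U. i \<in> p (h i) \<and> set S \<subseteq> set (h i)" by auto
  qed
  then show ?thesis using that U(2) by blast
qed

section \<open>Many independent functions on few points\<close>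

text \<open>
  A point \<open>(s, r)\<close> consists of a finite list \<open>s\<close> and a finite table \<open>r\<close>; the function belonging
  to the set \<open>A\<close> looks up the trace of \<open>A\<close> on \<open>s\<close> in the table.
\<close>

definition lookup :: "'b set \<Rightarrow> 'b list \<times> ('b list \<times> 'l list) list \<Rightarrow> 'l list" where
  "lookup A i = the (map_of (snd i) (filter (\<lambda>x. x \<in> A) (fst i)))"

text \<open>One element from the symmetric difference of each pair of distinct sets in
  \<open>N\<close> suffices to tell their traces apart.\<close>

lemma separating_list:
  assumes "finite N"
  shows "\<exists>s :: 'b list. inj_on (\<lambda>A. filter (\<lambda>x. x \<in> A) s) N"
proof -
  define d where "d A B = (SOME x :: 'b. x \<in> A - B \<union> (B - A))" for A B
  have d: "d A B \<in> A - B \<union> (B - A)" if "A \<noteq> B" for A B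
    unfolding d_def by (rule someI_ex) (use that in blast)
  have "finite ((\<lambda>(A, B). d A B) ` (N \<times> N))" using assms by simp
  then obtain s where s: "set s = (\<lambda>(A, B). d A B) ` (N \<times> N)" by (metis finite_list)
  have "A = B" if AB: "A \<in> N" "B \<in> N" and eq: "filter (\<lambda>x. x \<in> A) s = filter (\<lambda>x. x \<in> B) s" for A B
  proof (rule ccontr)
    assume ne: "A \<noteq> B"
    have "d A B \<in> set s" using AB s by auto
    moreover have "set s \<inter> A = set s \<inter> B" using arg_cong[OF eq, of set] by auto
    ultimately show False using d[OF ne] by blast
  qed
  then show ?thesis by (auto simp: inj_on_def)
qed

text \<open>The Engelking-Karlowicz construction. A list separating the sets in \<open>N\<close>
  gives them distinct traces, so one table can assign the prescribed value \<open>v A\<close> to the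
  trace of each \<open>A\<close>.\<close>

lemma independent_over_lookup: "independent_over (lookup :: 'b set \<Rightarrow> _ \<Rightarrow> 'l list) UNIV {}"
  unfolding independent_over_def
proof (intro allI impI, elim conjE)
  fix D :: "('b list \<times> ('b list \<times> 'l list) list) set set" and N :: "'b set set"
    and v :: "'b set \<Rightarrow> 'l list"
  assume D: "D \<subseteq> {}" and N: "finite N"
  obtain s :: "'b list" where s: "inj_on (\<lambda>A. filter (\<lambda>x. x \<in> A) s) N"
    using separating_list[OF N] by blast
  obtain L where L: "set L = N" "distinct L" using finite_distinct_list[OF N] by blast
  let ?t = "\<lambda>A. filter (\<lambda>x. x \<in> A) s"
  let ?r = "map (\<lambda>A. (?t A, v A)) L"
  have "distinct (map ?t L)" using s L by (simp add: distinct_map)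
  then have dist: "distinct (map fst ?r)" by (simp add: comp_def)
  have "lookup A (s, ?r) = v A" if "A \<in> N" for A
  proof -
    have "(?t A, v A) \<in> set ?r" using that L by auto
    then have "map_of ?r (?t A) = Some (v A)" using dist by (rule map_of_is_SomeI[rotated])
    then show ?thesis unfolding lookup_def by simp
  qed
  then show "\<exists>i\<in>\<Inter>D. \<forall>k\<in>N. lookup k i = v k" using D by auto
qed

section \<open>Coding and the existence of good ultrafilters\<close>

text \<open>Lists are nested through the pairing \<open>pr\<close>, with \<open>x\<close> and
  \<open>y\<close> as tags for the empty list and for a cons.\<close>

lemma inj_list_encoding:
  assumes "inj (pr :: 'b \<times> 'b \<Rightarrow> 'b)" "inj (c :: 'a \<Rightarrow> 'b)" "x \<noteq> (y :: 'b)"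
  shows "\<exists>e :: 'a list \<Rightarrow> 'b. inj e"
proof -
  define e where "e = rec_list (pr (x, x)) (\<lambda>a _ r. pr (y, pr (c a, r)))"
  have e: "e [] = pr (x, x)" "e (a # as) = pr (y, pr (c a, e as))" for a as
    unfolding e_def by simp_all
  have "as = bs" if "e as = e bs" for as bs
    using that
  proof (induction as arbitrary: bs)
    case Nil
    then show ?case using assms by (cases bs) (auto simp: e inj_eq)
  next
    case (Cons a as)
    then show ?case using assms by (cases bs) (auto simp: e inj_eq)
  qed
  then show ?thesis by (auto simp: inj_def)
qed

text \<open>A family \<open>p\<close> amounts to a set of pairs of a list and a point; this
  injection codes it by a subset of \<open>'b\<close>.\<close>

lemma inj_points:
  fixes j :: "'l \<Rightarrow> 'b"
  assumes inf: "infinite (UNIV :: 'b set)" and j: "inj j"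
  shows "\<exists>e :: 'l list \<times> 'b list \<times> ('b list \<times> 'l list) list \<Rightarrow> 'b. inj e"
proof -
  obtain pr :: "'b \<times> 'b \<Rightarrow> 'b" where "bij_betw pr (UNIV \<times> UNIV) UNIV"
    using card_of_Times_same_infinite[OF inf] card_of_ordIso by meson
  then have pr: "inj pr" by (simp add: bij_betw_def)
  obtain x :: 'b where "x \<notin> {undefined}" using ex_new_if_finite[OF inf] by blast
  then have xy: "x \<noteq> undefined" by simp
  obtain el :: "'l list \<Rightarrow> 'b" where el: "inj el" using inj_list_encoding[OF pr j xy] by blast
  obtain eb :: "'b list \<Rightarrow> 'b" where eb: "inj eb" using inj_list_encoding[OF pr inj_on_id xy] by blast
  have "inj (\<lambda>(s, t). pr (eb s, el t))"
    by (auto intro!: injI simp: inj_eq[OF pr] inj_eq[OF eb] inj_eq[OF el])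
  then obtain er :: "('b list \<times> 'l list) list \<Rightarrow> 'b" where er: "inj er"
    using inj_list_encoding[OF pr _ xy] by blast
  have "inj (\<lambda>(u, s, r). pr (el u, pr (eb s, er r)))"
    by (auto intro!: injI simp: inj_eq[OF pr] inj_eq[OF eb] inj_eq[OF el] inj_eq[OF er])
  then show ?thesis by blast
qed

lemma good_filter_filtermap:
  assumes good: "good_filter TYPE('l) U" and \<phi>: "inj \<phi>"
  shows "good_filter TYPE('l) (filtermap \<phi> U)"
  unfolding good_filter_def eventually_filtermap
proof (intro allI impI, elim conjE)
  fix p :: "'l list \<Rightarrow> _"
  assume p: "antitone_family p" "\<forall>S. \<forall>\<^sub>F i in U. \<phi> i \<in> p S"
  have "antitone_family (\<lambda>S. \<phi> -` p S)"
    using p(1) unfolding antitone_family_def by blast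
  then obtain h where h: "\<forall>S. \<forall>\<^sub>F i in U. i \<in> \<phi> -` p (h i) \<and> set S \<subseteq> set (h i)"
    using good[unfolded good_filter_def, rule_format, of "\<lambda>S. \<phi> -` p S"] p(2) by auto
  show "\<exists>h. \<forall>S. \<forall>\<^sub>F i in U. \<phi> i \<in> p (h (\<phi> i)) \<and> set S \<subseteq> set (h (\<phi> i))"
    by (rule exI[of _ "h \<circ> inv \<phi>"]) (use h \<phi> in simp)
qed

text \<open>The counting condition: families are coded by elements of \<open>'b set\<close>, and the
  same type indexes the functions \<open>lookup\<close>, so there are enough of them.\<close>

theorem good_ultrafilter_exists:
  fixes j :: "'l \<Rightarrow> 'b"
  assumes inf: "infinite (UNIV :: 'b set)" and j: "inj j"
  obtains I and U :: "'b set filter" where "ultrafilter_on I U" "good_filter TYPE('l) U"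
proof -
  obtain e :: "'l list \<times> 'b list \<times> ('b list \<times> 'l list) list \<Rightarrow> 'b" where e: "inj e"
    using inj_points[OF assms] by blast
  define dec where "dec B S = {i. e (S, i) \<in> B}" for B S
  have "surj dec"
  proof (rule surjI)
    fix p show "dec (e ` {(S, i). i \<in> p S}) = p"
      by (auto simp: dec_def fun_eq_iff inj_image_mem_iff[OF e])
  qed
  moreover have "infinite (UNIV :: 'b set set)"
    using inf by (metis finite_Pow_iff Pow_UNIV)
  ultimately obtain U :: "('b list \<times> ('b list \<times> 'l list) list) filter"
    where U: "ultrafilter_on UNIV U" "good_filter TYPE('l) U"
    using good_ultrafilter_from_independent[OF _ independent_over_lookup, of dec] by metis
  \<comment> \<open>Singletons move the points into \<open>'b set\<close>, so that the index type no
    longer depends on \<open>'l\<close>.\<close>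
  define \<phi> where "\<phi> i = {e ([], i)}" for i
  have \<phi>: "inj \<phi>" using e by (auto simp: \<phi>_def inj_def)
  have "ultrafilter_on (range \<phi>) (filtermap \<phi> U)"
    using U(1) by (auto simp: ultrafilter_on_def filtermap_bot_iff le_principal eventually_filtermap)
  then show ?thesis using that good_filter_filtermap[OF U(2) \<phi>] by blast
qed

section \<open>Saturation\<close>

text \<open>With \<open>p S\<close> the set of indices at which the conditions in \<open>S\<close>
  have a common solution, goodness yields finite lists \<open>h i\<close>, soluble at almost every
  \<open>i\<close>, such that each single condition belongs to almost all of them. Then
  \<open>f i\<close> is chosen to solve \<open>h i\<close>.\<close>

lemma saturation:
  fixes Q :: "'l \<Rightarrow> 'i \<Rightarrow> 'a \<Rightarrow> bool"
  assumes U: "ultrafilter_on I U" and good: "good_filter TYPE('l) U"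
    and fsat: "\<And>S. finite S \<Longrightarrow> \<forall>\<^sub>F i in U. \<exists>a\<in>V. \<forall>l\<in>S. Q l i a"
  obtains f where "f \<in> I \<rightarrow>\<^sub>E V" "\<And>l. \<forall>\<^sub>F i in U. Q l i (f i)"
proof -
  have Ub: "U \<noteq> bot" and UI: "\<forall>\<^sub>F i in U. i \<in> I"
    using U by (auto simp: ultrafilter_on_def le_principal)
  define p where "p S = {i. \<exists>a\<in>V. \<forall>l\<in>set S. Q l i a}" for S
  have "antitone_family p" unfolding antitone_family_def p_def by blast
  moreover have "\<forall>S. \<forall>\<^sub>F i in U. i \<in> p S" using fsat by (simp add: p_def)
  ultimately obtain h where h: "\<And>S. \<forall>\<^sub>F i in U. i \<in> p (h i) \<and> set S \<subseteq> set (h i)"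
    using good unfolding good_filter_def by blast
  \<comment> \<open>Some element of \<open>V\<close> must serve as the value at indices where
    \<open>h i\<close> has no solution.\<close>
  have "\<exists>a. a \<in> V" using eventually_happens'[OF Ub fsat[of "{}"]] by auto
  then have "\<forall>i. \<exists>a. a \<in> V \<and> (i \<in> p (h i) \<longrightarrow> (\<forall>l\<in>set (h i). Q l i a))"
    unfolding p_def by blast
  then obtain f where f: "\<And>i. f i \<in> V" "\<And>i l. i \<in> p (h i) \<Longrightarrow> l \<in> set (h i) \<Longrightarrow> Q l i (f i)"
    by metis
  show ?thesis
  proof
    show "restrict f I \<in> I \<rightarrow>\<^sub>E V" using f(1) by auto
    fix l show "\<forall>\<^sub>F i in U. Q l i (restrict f I i)"
      using h[of "[l]"] UI by eventually_elim (use f(2) in auto)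
  qed
qed

section \<open>Representing the canonical extension in the ultrapower\<close>

lemma embedding_le:
  assumes "lattice_embedding L C e" "a \<in> carrier L" "b \<in> carrier L" "a \<sqsubseteq>\<^bsub>L\<^esub> b"
  shows "e a \<sqsubseteq>\<^bsub>C\<^esub> e b"
  using join_pres_isotone[of e L C] assms unfolding lattice_embedding_def isotone_def by blast

text \<open>Binary joins give the induction step; preservation of the bottom element covers empty
  \<open>T\<close>.\<close>

lemma embedding_finite_sup_le:
  assumes L: "complete_lattice L" and C: "complete_lattice C" and e: "lattice_embedding L C e"
    and T: "finite T" "T \<subseteq> carrier L" and b: "b \<in> carrier C" "\<And>a. a \<in> T \<Longrightarrow> e a \<sqsubseteq>\<^bsub>C\<^esub> b"
  shows "e (\<Squnion>\<^bsub>L\<^esub> T) \<sqsubseteq>\<^bsub>C\<^esub> b"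
proof -
  interpret L: complete_lattice L by fact
  interpret C: complete_lattice C by fact
  have ec: "e a \<in> carrier C" if "a \<in> carrier L" for a
    using e that unfolding lattice_embedding_def by auto
  show ?thesis using T b(2)
  proof (induction T rule: finite_induct)
    case empty
    have "\<Squnion>\<^bsub>L\<^esub> {} = \<bottom>\<^bsub>L\<^esub>" using L.weak_sup_empty unfolding L.eq_is_equal .
    then show ?case using e b(1) C.bottom_lower unfolding lattice_embedding_def by simp
  next
    case (insert a T)
    have c: "a \<in> carrier L" "\<Squnion>\<^bsub>L\<^esub> T \<in> carrier L" using insert.prems(1) by auto
    have "\<Squnion>\<^bsub>L\<^esub> (insert a T) = a \<squnion>\<^bsub>L\<^esub> \<Squnion>\<^bsub>L\<^esub> T"
      using L.weak_sup_insert insert.prems(1) unfolding L.eq_is_equal by simp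
    then have "e (\<Squnion>\<^bsub>L\<^esub> (insert a T)) = e a \<squnion>\<^bsub>C\<^esub> e (\<Squnion>\<^bsub>L\<^esub> T)"
      using e c unfolding lattice_embedding_def join_pres_def by simp
    also have "\<dots> \<sqsubseteq>\<^bsub>C\<^esub> b"
      by (rule C.join_le) (use insert c ec b(1) in auto)
    finally show ?case .
  qed
qed

lemma embedding_le_finite_inf:
  assumes L: "complete_lattice L" and C: "complete_lattice C" and e: "lattice_embedding L C e"
    and S: "finite S" "S \<subseteq> carrier L" and b: "b \<in> carrier C" "\<And>a. a \<in> S \<Longrightarrow> b \<sqsubseteq>\<^bsub>C\<^esub> e a"
  shows "b \<sqsubseteq>\<^bsub>C\<^esub> e (\<Sqinter>\<^bsub>L\<^esub> S)"
proof -
  interpret L: complete_lattice L by fact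
  interpret C: complete_lattice C by fact
  have ec: "e a \<in> carrier C" if "a \<in> carrier L" for a
    using e that unfolding lattice_embedding_def by auto
  show ?thesis using S b(2)
  proof (induction S rule: finite_induct)
    case empty
    have "\<Sqinter>\<^bsub>L\<^esub> {} = \<top>\<^bsub>L\<^esub>" using L.weak_inf_empty unfolding L.eq_is_equal .
    then show ?case using e b(1) C.top_higher unfolding lattice_embedding_def by simp
  next
    case (insert a S)
    have c: "a \<in> carrier L" "\<Sqinter>\<^bsub>L\<^esub> S \<in> carrier L" using insert.prems(1) by auto
    have "\<Sqinter>\<^bsub>L\<^esub> (insert a S) = a \<sqinter>\<^bsub>L\<^esub> \<Sqinter>\<^bsub>L\<^esub> S"
      using L.weak_inf_insert insert.prems(1) unfolding L.eq_is_equal by simp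
    then have "e (\<Sqinter>\<^bsub>L\<^esub> (insert a S)) = e a \<sqinter>\<^bsub>C\<^esub> e (\<Sqinter>\<^bsub>L\<^esub> S)"
      using e c unfolding lattice_embedding_def meet_pres_def by simp
    moreover have "b \<sqsubseteq>\<^bsub>C\<^esub> e a \<sqinter>\<^bsub>C\<^esub> e (\<Sqinter>\<^bsub>L\<^esub> S)"
      by (rule C.meet_le) (use insert c ec b(1) in auto)
    ultimately show ?case by simp
  qed
qed

section \<open>Points of the ultrapower and elements of the canonical extension\<close>

locale good_ultrapower =
  fixes P :: "('x, 'y) polarity" and I :: "'i set" and U :: "'i filter"
    and C :: "'c gorder" and e :: "'x set \<Rightarrow> 'c"
  assumes ultra: "ultrafilter_on I U"
    and good: "good_filter TYPE('x set) U"
    and ext: "canonical_extension (stable_lattice P) C e"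
begin

abbreviation L where "L \<equiv> stable_lattice P"
abbreviation X where "X \<equiv> pol_X P"
abbreviation Y where "Y \<equiv> pol_Y P"
abbreviation R where "R \<equiv> pol_R P"
abbreviation PU where "PU \<equiv> ultrapower I U P"

definition types_X :: "('i \<Rightarrow> 'x) \<Rightarrow> 'x set set" where
  "types_X f = {A. stable_set P A \<and> (\<forall>\<^sub>F i in U. f i \<in> A)}"

definition types_Y :: "('i \<Rightarrow> 'y) \<Rightarrow> 'x set set" where
  "types_Y g = {A. stable_set P A \<and> (\<forall>\<^sub>F i in U. g i \<in> rho P A)}"

definition phi :: "('i \<Rightarrow> 'x) \<Rightarrow> 'c" where "phi f = \<Sqinter>\<^bsub>C\<^esub> (e ` types_X f)"

definition psi :: "('i \<Rightarrow> 'y) \<Rightarrow> 'c" where "psi g = \<Squnion>\<^bsub>C\<^esub> (e ` types_Y g)"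

lemma complete_C: "complete_lattice C" and emb: "lattice_embedding L C e"
  and dense: "dense_in L C e" and comp: "compact_in L C e"
  using ext unfolding canonical_extension_def by blast+

sublocale C: complete_lattice C by (rule complete_C)

lemma carrier_L: "A \<in> carrier L \<longleftrightarrow> stable_set P A"
  by (simp add: stable_lattice_def)

lemma e_closed: "S \<subseteq> carrier L \<Longrightarrow> e ` S \<subseteq> carrier C"
  using emb unfolding lattice_embedding_def by auto

lemma types_sub: "types_X f \<subseteq> carrier L" "types_Y g \<subseteq> carrier L"
  unfolding types_X_def types_Y_def by (auto simp: carrier_L)

lemma phi_psi_closed [simp]: "phi f \<in> carrier C" "psi g \<in> carrier C"
  unfolding phi_def psi_def using e_closed types_sub by (simp_all add: C.inf_closed C.sup_closed)

lemma eventually_I: "\<forall>\<^sub>F i in U. i \<in> I"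
  and not_eventually_iff: "\<not> eventually Q U \<longleftrightarrow> (\<forall>\<^sub>F i in U. \<not> Q i)"
proof -
  have b: "U \<noteq> bot" using ultra by (simp add: ultrafilter_on_def)
  show "\<forall>\<^sub>F i in U. i \<in> I" using ultra by (simp add: ultrafilter_on_def le_principal)
  have "False" if "eventually Q U" "\<forall>\<^sub>F i in U. \<not> Q i"
  proof -
    have "\<forall>\<^sub>F i in U. False" using that by eventually_elim simp
    then show False using b by (simp add: trivial_limit_def)
  qed
  then show "\<not> eventually Q U \<longleftrightarrow> (\<forall>\<^sub>F i in U. \<not> Q i)"
    using ultra unfolding ultrafilter_on_def by blast
qed

lemma inf_le_e: "S \<subseteq> carrier L \<Longrightarrow> A \<in> S \<Longrightarrow> \<Sqinter>\<^bsub>C\<^esub> (e ` S) \<sqsubseteq>\<^bsub>C\<^esub> e A"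
  by (intro C.inf_lower e_closed imageI)

lemma e_le_sup: "S \<subseteq> carrier L \<Longrightarrow> A \<in> S \<Longrightarrow> e A \<sqsubseteq>\<^bsub>C\<^esub> \<Squnion>\<^bsub>C\<^esub> (e ` S)"
  by (intro C.sup_upper e_closed imageI)

text \<open>The factor \<open>X\<close> takes care of empty \<open>S'\<close>, whose meet in
  \<open>L\<close> is the top element.\<close>

lemma inf_le_e_inf:
  assumes "S \<subseteq> carrier L" "finite S'" "S' \<subseteq> S"
  shows "\<Sqinter>\<^bsub>C\<^esub> (e ` S) \<sqsubseteq>\<^bsub>C\<^esub> e (X \<inter> \<Inter>S')"
proof -
  have S': "S' \<subseteq> carrier L" using assms by blast
  show ?thesis
    unfolding stable_lattice_inf[OF S', symmetric]
    by (rule embedding_le_finite_inf[OF complete_lattice_stable_lattice complete_C emb assms(2) S'])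
      (use assms inf_le_e[OF assms(1)] C.inf_closed[OF e_closed[OF assms(1)]] in auto)
qed

lemma e_sup_le_sup:
  assumes "T \<subseteq> carrier L" "finite T'" "T' \<subseteq> T"
  shows "e (lam P (rho P (\<Union>T'))) \<sqsubseteq>\<^bsub>C\<^esub> \<Squnion>\<^bsub>C\<^esub> (e ` T)"
proof -
  have T': "T' \<subseteq> carrier L" using assms by blast
  show ?thesis
    unfolding stable_lattice_sup[OF T', symmetric]
    by (rule embedding_finite_sup_le[OF complete_lattice_stable_lattice complete_C emb assms(2) T'])
      (use assms e_le_sup[OF assms(1)] C.sup_closed[OF e_closed[OF assms(1)]] in auto)
qed

text \<open>By density \<open>z\<close> is a join of closed elements, that is, of meets of images;
  were all of them below \<open>w\<close>, so would \<open>z\<close> be.\<close>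

lemma closed_below:
  assumes z: "z \<in> carrier C" and w: "w \<in> carrier C" and n: "\<not> z \<sqsubseteq>\<^bsub>C\<^esub> w"
  obtains S where "S \<subseteq> carrier L" "\<Sqinter>\<^bsub>C\<^esub> (e ` S) \<sqsubseteq>\<^bsub>C\<^esub> z" "\<not> \<Sqinter>\<^bsub>C\<^esub> (e ` S) \<sqsubseteq>\<^bsub>C\<^esub> w"
proof -
  obtain \<S> where \<S>: "\<S> \<subseteq> Pow (carrier L)" and ze: "z = \<Squnion>\<^bsub>C\<^esub> {\<Sqinter>\<^bsub>C\<^esub> (e ` S) | S. S \<in> \<S>}" (is "_ = \<Squnion>\<^bsub>C\<^esub> ?G")
    using dense z unfolding dense_in_def by meson
  have sub: "?G \<subseteq> carrier C" using \<S> C.inf_closed[OF e_closed] by blast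
  obtain S where S: "S \<in> \<S>" "\<not> \<Sqinter>\<^bsub>C\<^esub> (e ` S) \<sqsubseteq>\<^bsub>C\<^esub> w"
    using C.sup_least[OF sub w] n unfolding ze by blast
  moreover have "\<Sqinter>\<^bsub>C\<^esub> (e ` S) \<sqsubseteq>\<^bsub>C\<^esub> z" unfolding ze by (rule C.sup_upper[OF sub]) (use S in blast)
  ultimately show ?thesis using that \<S> by blast
qed

text \<open>The dual, with open elements, the joins of images.\<close>

lemma open_above:
  assumes z: "z \<in> carrier C" and w: "w \<in> carrier C" and n: "\<not> w \<sqsubseteq>\<^bsub>C\<^esub> z"
  obtains T where "T \<subseteq> carrier L" "z \<sqsubseteq>\<^bsub>C\<^esub> \<Squnion>\<^bsub>C\<^esub> (e ` T)" "\<not> w \<sqsubseteq>\<^bsub>C\<^esub> \<Squnion>\<^bsub>C\<^esub> (e ` T)"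
proof -
  obtain \<T> where \<T>: "\<T> \<subseteq> Pow (carrier L)" and ze: "z = \<Sqinter>\<^bsub>C\<^esub> {\<Squnion>\<^bsub>C\<^esub> (e ` T) | T. T \<in> \<T>}" (is "_ = \<Sqinter>\<^bsub>C\<^esub> ?G")
    using dense z unfolding dense_in_def by meson
  have sub: "?G \<subseteq> carrier C" using \<T> C.sup_closed[OF e_closed] by blast
  obtain T where T: "T \<in> \<T>" "\<not> w \<sqsubseteq>\<^bsub>C\<^esub> \<Squnion>\<^bsub>C\<^esub> (e ` T)"
    using C.inf_greatest[OF sub w] n unfolding ze by blast
  moreover have "z \<sqsubseteq>\<^bsub>C\<^esub> \<Squnion>\<^bsub>C\<^esub> (e ` T)" unfolding ze by (rule C.inf_lower[OF sub]) (use T in blast)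
  ultimately show ?thesis using that \<T> by blast
qed

lemma phi_le_inf:
  assumes "S \<subseteq> carrier L" "\<And>A. A \<in> S \<Longrightarrow> \<forall>\<^sub>F i in U. f i \<in> A"
  shows "phi f \<sqsubseteq>\<^bsub>C\<^esub> \<Sqinter>\<^bsub>C\<^esub> (e ` S)"
proof -
  have "S \<subseteq> types_X f" using assms unfolding types_X_def carrier_L[symmetric] by auto
  then show ?thesis
    by (intro C.inf_greatest e_closed assms phi_psi_closed) (auto simp: phi_def intro!: inf_le_e types_sub)
qed

lemma sup_le_psi:
  assumes "T \<subseteq> carrier L" "\<And>A. A \<in> T \<Longrightarrow> \<forall>\<^sub>F i in U. g i \<in> rho P A"
  shows "\<Squnion>\<^bsub>C\<^esub> (e ` T) \<sqsubseteq>\<^bsub>C\<^esub> psi g"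
proof -
  have "T \<subseteq> types_Y g" using assms unfolding types_Y_def carrier_L[symmetric] by auto
  then show ?thesis
    by (intro C.sup_least e_closed assms phi_psi_closed) (auto simp: psi_def intro!: e_le_sup types_sub)
qed

text \<open>Compactness turns \<open>phi f\<close> \<le> \<open>psi g\<close> into an inclusion of a
  finite meet of stable sets in a finite join. Almost everywhere \<open>f i\<close> lies in that
  meet and \<open>g i\<close> is related to everything in that join.\<close>

lemma related_if_between:
  assumes f: "f \<in> I \<rightarrow>\<^sub>E X" and z: "z \<in> carrier C" "phi f \<sqsubseteq>\<^bsub>C\<^esub> z" "z \<sqsubseteq>\<^bsub>C\<^esub> psi g"
    and g: "g \<in> I \<rightarrow>\<^sub>E Y"
  shows "\<forall>\<^sub>F i in U. (f i, g i) \<in> R"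
proof -
  have "phi f \<sqsubseteq>\<^bsub>C\<^esub> psi g" using C.le_trans[OF z(2,3)] z(1) by simp
  then obtain S T where S: "finite S" "S \<subseteq> types_X f" and T: "finite T" "T \<subseteq> types_Y g"
    and le: "\<Sqinter>\<^bsub>L\<^esub> S \<sqsubseteq>\<^bsub>L\<^esub> \<Squnion>\<^bsub>L\<^esub> T"
    using comp types_sub unfolding compact_in_def phi_def psi_def by meson
  have sub: "X \<inter> \<Inter>S \<subseteq> lam P (rho P (\<Union>T))"
    using le stable_lattice_inf[of S P] stable_lattice_sup[of T P] S T types_sub
    by (simp add: stable_lattice_def) blast
  have "\<forall>\<^sub>F i in U. \<forall>A\<in>S. f i \<in> A"
    by (rule eventually_ball_finite[OF S(1)]) (use S(2) in \<open>auto simp: types_X_def\<close>)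
  moreover have "\<forall>\<^sub>F i in U. \<forall>A\<in>T. g i \<in> rho P A"
    by (rule eventually_ball_finite[OF T(1)]) (use T(2) in \<open>auto simp: types_Y_def\<close>)
  ultimately show ?thesis using eventually_I
  proof eventually_elim
    case (elim i)
    then have "f i \<in> lam P (rho P (\<Union>T))" using sub f by auto
    moreover have "g i \<in> rho P (\<Union>T)" using elim g by (auto simp: rho_def)
    ultimately show ?case by (auto simp: lam_def)
  qed
qed

text \<open>An open element above \<open>z\<close> but not above \<open>phi f\<close> gives the
  conditions on \<open>g\<close>. If finitely many of them failed, \<open>f\<close> would lie almost
  everywhere in a finite join of members of \<open>T\<close>, forcing \<open>phi f\<close> below the
  open element.\<close>

lemma unrelated_above:
  assumes f: "f \<in> I \<rightarrow>\<^sub>E X" and z: "z \<in> carrier C" and n: "\<not> phi f \<sqsubseteq>\<^bsub>C\<^esub> z"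
  obtains g where "g \<in> I \<rightarrow>\<^sub>E Y" "z \<sqsubseteq>\<^bsub>C\<^esub> psi g" "\<not> (\<forall>\<^sub>F i in U. (f i, g i) \<in> R)"
proof -
  obtain T where T: "T \<subseteq> carrier L" "z \<sqsubseteq>\<^bsub>C\<^esub> \<Squnion>\<^bsub>C\<^esub> (e ` T)" "\<not> phi f \<sqsubseteq>\<^bsub>C\<^esub> \<Squnion>\<^bsub>C\<^esub> (e ` T)"
    using open_above[OF z _ n] by auto
  \<comment> \<open>Non-relatedness is attached to every index \<open>A\<close>, so that subsets of
    \<open>X\<close> suffice as indices of the conditions; it is read off at \<open>{}\<close> in
    the end.\<close>
  have "\<forall>\<^sub>F i in U. \<exists>y\<in>Y. \<forall>A\<in>S. (A \<in> T \<longrightarrow> y \<in> rho P A) \<and> (f i, y) \<notin> R" if S: "finite S" for S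
  proof -
    let ?B = "lam P (rho P (\<Union>(S \<inter> T)))"
    have B: "?B \<in> carrier L" unfolding carrier_L by (rule stable_lam[OF rho_subset])
    have "\<not> (\<forall>\<^sub>F i in U. f i \<in> ?B)"
    proof
      assume "\<forall>\<^sub>F i in U. f i \<in> ?B"
      then have "phi f \<sqsubseteq>\<^bsub>C\<^esub> e ?B"
        unfolding phi_def using B by (intro inf_le_e types_sub) (simp add: types_X_def carrier_L)
      also have "e ?B \<sqsubseteq>\<^bsub>C\<^esub> \<Squnion>\<^bsub>C\<^esub> (e ` T)" by (rule e_sup_le_sup) (use S T in auto)
      finally show False using T B e_closed[of "{?B}"] e_closed[OF T(1)] by simp
    qed
    then have "\<forall>\<^sub>F i in U. f i \<notin> ?B" by (simp add: not_eventually_iff)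
    then show ?thesis using eventually_I
    proof eventually_elim
      case (elim i)
      then obtain y where "y \<in> rho P (\<Union>(S \<inter> T))" "(f i, y) \<notin> R" using f by (auto simp: lam_def)
      then show ?case by (intro bexI[of _ y]) (auto simp: rho_def)
    qed
  qed
  from saturation[OF ultra good this] obtain g where g: "g \<in> I \<rightarrow>\<^sub>E Y"
    "\<And>A. \<forall>\<^sub>F i in U. (A \<in> T \<longrightarrow> g i \<in> rho P A) \<and> (f i, g i) \<notin> R" by blast
  have "\<Squnion>\<^bsub>C\<^esub> (e ` T) \<sqsubseteq>\<^bsub>C\<^esub> psi g"
    by (rule sup_le_psi[OF T(1)]) (rule eventually_mono[OF g(2)], blast)
  then have "z \<sqsubseteq>\<^bsub>C\<^esub> psi g" using C.le_trans[OF T(2)] z e_closed[OF T(1)] by simp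
  moreover have "\<not> (\<forall>\<^sub>F i in U. (f i, g i) \<in> R)"
    unfolding not_eventually_iff using g(2)[of "{}"] by (auto elim: eventually_mono)
  ultimately show ?thesis using that g(1) by blast
qed

text \<open>The dual: if the conditions failed, \<open>g i\<close> would lie in \<open>rho\<close>
  of a finite meet of members of \<open>S\<close> almost everywhere, putting a closed element below
  \<open>psi g\<close> against its choice.\<close>

lemma unrelated_below:
  assumes g: "g \<in> I \<rightarrow>\<^sub>E Y" and z: "z \<in> carrier C" and n: "\<not> z \<sqsubseteq>\<^bsub>C\<^esub> psi g"
  obtains f where "f \<in> I \<rightarrow>\<^sub>E X" "phi f \<sqsubseteq>\<^bsub>C\<^esub> z" "\<not> (\<forall>\<^sub>F i in U. (f i, g i) \<in> R)"
proof -
  obtain S where S: "S \<subseteq> carrier L" "\<Sqinter>\<^bsub>C\<^esub> (e ` S) \<sqsubseteq>\<^bsub>C\<^esub> z" "\<not> \<Sqinter>\<^bsub>C\<^esub> (e ` S) \<sqsubseteq>\<^bsub>C\<^esub> psi g"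
    using closed_below[OF z _ n] by auto
  have "\<forall>\<^sub>F i in U. \<exists>x\<in>X. \<forall>A\<in>T. (A \<in> S \<longrightarrow> x \<in> A) \<and> (x, g i) \<notin> R" if T: "finite T" for T
  proof -
    let ?B = "X \<inter> \<Inter>(T \<inter> S)"
    have B: "?B \<in> carrier L" unfolding carrier_L by (rule stable_Inter) (use S in \<open>auto simp: carrier_L\<close>)
    have "\<not> (\<forall>\<^sub>F i in U. g i \<in> rho P ?B)"
    proof
      assume "\<forall>\<^sub>F i in U. g i \<in> rho P ?B"
      then have le: "e ?B \<sqsubseteq>\<^bsub>C\<^esub> psi g"
        unfolding psi_def using B by (intro e_le_sup types_sub) (simp add: types_Y_def carrier_L)
      have "\<Sqinter>\<^bsub>C\<^esub> (e ` S) \<sqsubseteq>\<^bsub>C\<^esub> e ?B" by (rule inf_le_e_inf) (use S T in auto)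
      also note le
      finally show False using S B e_closed[of "{?B}"] e_closed[OF S(1)] by simp
    qed
    then have "\<forall>\<^sub>F i in U. g i \<notin> rho P ?B" by (simp add: not_eventually_iff)
    then show ?thesis using eventually_I
    proof eventually_elim
      case (elim i)
      then obtain x where "x \<in> ?B" "(x, g i) \<notin> R" using g by (auto simp: rho_def)
      then show ?case by (intro bexI[of _ x]) auto
    qed
  qed
  from saturation[OF ultra good this] obtain f where f: "f \<in> I \<rightarrow>\<^sub>E X"
    "\<And>A. \<forall>\<^sub>F i in U. (A \<in> S \<longrightarrow> f i \<in> A) \<and> (f i, g i) \<notin> R" by blast
  have "phi f \<sqsubseteq>\<^bsub>C\<^esub> \<Sqinter>\<^bsub>C\<^esub> (e ` S)"
    by (rule phi_le_inf[OF S(1)]) (rule eventually_mono[OF f(2)], blast)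
  then have "phi f \<sqsubseteq>\<^bsub>C\<^esub> z" using C.le_trans[OF _ S(2)] z e_closed[OF S(1)] by simp
  moreover have "\<not> (\<forall>\<^sub>F i in U. (f i, g i) \<in> R)"
    unfolding not_eventually_iff using f(2)[of "{}"] by (auto elim: eventually_mono)
  ultimately show ?thesis using that f(1) by blast
qed

text \<open>This serves injectivity. Neither point is given, so saturation is applied to pairs. A
  failing finite subfamily would put a finite meet from \<open>S\<close> inside a finite join from
  \<open>T\<close>, contrary to the choice of the closed and the open element.\<close>

lemma unrelated_between:
  assumes z: "z \<in> carrier C" and w: "w \<in> carrier C" and n: "\<not> z \<sqsubseteq>\<^bsub>C\<^esub> w"
  obtains f g where "f \<in> I \<rightarrow>\<^sub>E X" "g \<in> I \<rightarrow>\<^sub>E Y" "phi f \<sqsubseteq>\<^bsub>C\<^esub> z" "w \<sqsubseteq>\<^bsub>C\<^esub> psi g"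
    "\<not> (\<forall>\<^sub>F i in U. (f i, g i) \<in> R)"
proof -
  obtain S where S: "S \<subseteq> carrier L" "\<Sqinter>\<^bsub>C\<^esub> (e ` S) \<sqsubseteq>\<^bsub>C\<^esub> z" "\<not> \<Sqinter>\<^bsub>C\<^esub> (e ` S) \<sqsubseteq>\<^bsub>C\<^esub> w"
    using closed_below[OF z w n] .
  have Sc: "\<Sqinter>\<^bsub>C\<^esub> (e ` S) \<in> carrier C" using e_closed[OF S(1)] by simp
  obtain T where T: "T \<subseteq> carrier L" "w \<sqsubseteq>\<^bsub>C\<^esub> \<Squnion>\<^bsub>C\<^esub> (e ` T)"
    "\<not> \<Sqinter>\<^bsub>C\<^esub> (e ` S) \<sqsubseteq>\<^bsub>C\<^esub> \<Squnion>\<^bsub>C\<^esub> (e ` T)"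
    using open_above[OF w Sc S(3)] .
  have Tc: "\<Squnion>\<^bsub>C\<^esub> (e ` T) \<in> carrier C" using e_closed[OF T(1)] by simp
  have "\<exists>p\<in>X \<times> Y. \<forall>A\<in>S0. (A \<in> S \<longrightarrow> fst p \<in> A) \<and> (A \<in> T \<longrightarrow> snd p \<in> rho P A) \<and> p \<notin> R"
    if S0: "finite S0" for S0
  proof -
    let ?A = "X \<inter> \<Inter>(S0 \<inter> S)" and ?B = "lam P (rho P (\<Union>(S0 \<inter> T)))"
    have A: "?A \<in> carrier L" unfolding carrier_L by (rule stable_Inter) (use S in \<open>auto simp: carrier_L\<close>)
    have B: "?B \<in> carrier L" unfolding carrier_L by (rule stable_lam[OF rho_subset])
    have "\<not> ?A \<subseteq> ?B"
    proof
      assume "?A \<subseteq> ?B"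
      then have AB: "e ?A \<sqsubseteq>\<^bsub>C\<^esub> e ?B"
        by (intro embedding_le[OF emb A B]) (simp add: stable_lattice_def)
      have "\<Sqinter>\<^bsub>C\<^esub> (e ` S) \<sqsubseteq>\<^bsub>C\<^esub> e ?A" by (rule inf_le_e_inf) (use S S0 in auto)
      also note AB
      also have "e ?B \<sqsubseteq>\<^bsub>C\<^esub> \<Squnion>\<^bsub>C\<^esub> (e ` T)" by (rule e_sup_le_sup) (use T S0 in auto)
      finally show False using T(3) Sc Tc A B e_closed[of "{?A, ?B}"] by simp
    qed
    then obtain x y where "x \<in> ?A" "y \<in> rho P (\<Union>(S0 \<inter> T))" "(x, y) \<notin> R"
      by (auto simp: lam_def)
    then show ?thesis by (intro bexI[of _ "(x, y)"]) (auto simp: rho_def)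
  qed
  then have "\<forall>\<^sub>F i in U. \<exists>p\<in>X \<times> Y. \<forall>A\<in>S0. (A \<in> S \<longrightarrow> fst p \<in> A) \<and> (A \<in> T \<longrightarrow> snd p \<in> rho P A) \<and> p \<notin> R"
    if "finite S0" for S0
    using that by (intro always_eventually) blast
  from saturation[OF ultra good this] obtain k where k: "k \<in> I \<rightarrow>\<^sub>E X \<times> Y"
    "\<And>A. \<forall>\<^sub>F i in U. (A \<in> S \<longrightarrow> fst (k i) \<in> A) \<and> (A \<in> T \<longrightarrow> snd (k i) \<in> rho P A) \<and> k i \<notin> R"
    by blast
  define f g where "f = restrict (fst \<circ> k) I" and "g = restrict (snd \<circ> k) I"
  have fg: "f \<in> I \<rightarrow>\<^sub>E X" "g \<in> I \<rightarrow>\<^sub>E Y" using PiE_mem[OF k(1)] unfolding f_def g_def by (auto simp: mem_Times_iff)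
  have ev: "\<forall>\<^sub>F i in U. (A \<in> S \<longrightarrow> f i \<in> A) \<and> (A \<in> T \<longrightarrow> g i \<in> rho P A) \<and> (f i, g i) \<notin> R" for A
    using k(2)[of A] eventually_I by eventually_elim (simp add: f_def g_def)
  have "phi f \<sqsubseteq>\<^bsub>C\<^esub> \<Sqinter>\<^bsub>C\<^esub> (e ` S)"
    by (rule phi_le_inf[OF S(1)]) (rule eventually_mono[OF ev], blast)
  then have "phi f \<sqsubseteq>\<^bsub>C\<^esub> z" using C.le_trans[OF _ S(2)] z Sc by simp
  moreover have "\<Squnion>\<^bsub>C\<^esub> (e ` T) \<sqsubseteq>\<^bsub>C\<^esub> psi g"
    by (rule sup_le_psi[OF T(1)]) (rule eventually_mono[OF ev], blast)
  then have "w \<sqsubseteq>\<^bsub>C\<^esub> psi g" using C.le_trans[OF T(2)] w Tc by simp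
  moreover have "\<not> (\<forall>\<^sub>F i in U. (f i, g i) \<in> R)"
    unfolding not_eventually_iff using ev[of "{}"] by (auto elim: eventually_mono)
  ultimately show ?thesis using that fg by blast
qed

section \<open>The embedding\<close>

abbreviation cX where "cX \<equiv> upow_class I U X"
abbreviation cY where "cY \<equiv> upow_class I U Y"

lemma pol_X_PU: "pol_X PU = cX ` (I \<rightarrow>\<^sub>E X)" and pol_Y_PU: "pol_Y PU = cY ` (I \<rightarrow>\<^sub>E Y)"
  by (auto simp: ultrapower_def upow_set_def quotient_def)

definition up :: "'c \<Rightarrow> ('i \<Rightarrow> 'y) set set" where
  "up z = cY ` {g \<in> I \<rightarrow>\<^sub>E Y. z \<sqsubseteq>\<^bsub>C\<^esub> psi g}"

text \<open>Taking \<open>lam\<close> of a set on the other side makes stability immediate;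
  \<open>h_iff\<close> recovers the description by \<open>phi\<close>.\<close>

definition h :: "'c \<Rightarrow> ('i \<Rightarrow> 'x) set set" where
  "h z = lam PU (up z)"

lemma h_iff:
  assumes "f \<in> I \<rightarrow>\<^sub>E X" "z \<in> carrier C"
  shows "cX f \<in> h z \<longleftrightarrow> phi f \<sqsubseteq>\<^bsub>C\<^esub> z"
proof -
  have "cX f \<in> h z \<longleftrightarrow> (\<forall>g \<in> I \<rightarrow>\<^sub>E Y. z \<sqsubseteq>\<^bsub>C\<^esub> psi g \<longrightarrow> (cX f, cY g) \<in> pol_R PU)"
    unfolding h_def lam_def up_def pol_X_PU using assms by blast
  also have "\<dots> \<longleftrightarrow> (\<forall>g \<in> I \<rightarrow>\<^sub>E Y. z \<sqsubseteq>\<^bsub>C\<^esub> psi g \<longrightarrow> (\<forall>\<^sub>F i in U. (f i, g i) \<in> R))"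
    using ultrapower_rel_iff[OF assms(1)] by blast
  also have "\<dots> \<longleftrightarrow> phi f \<sqsubseteq>\<^bsub>C\<^esub> z" (is "?l \<longleftrightarrow> ?r")
  proof
    assume l: ?l
    show ?r
    proof (rule ccontr)
      assume "\<not> ?r"
      with assms show False by (rule unrelated_above) (use l in blast)
    qed
  qed (use related_if_between[OF assms] in blast)
  finally show ?thesis .
qed

lemma h_sub: "h z \<subseteq> cX ` (I \<rightarrow>\<^sub>E X)"
  unfolding h_def lam_def pol_X_PU by blast

lemma rho_h_iff:
  assumes "g \<in> I \<rightarrow>\<^sub>E Y" "z \<in> carrier C"
  shows "cY g \<in> rho PU (h z) \<longleftrightarrow> z \<sqsubseteq>\<^bsub>C\<^esub> psi g"
proof -
  have "cY g \<in> rho PU (h z) \<longleftrightarrow> (\<forall>f \<in> I \<rightarrow>\<^sub>E X. cX f \<in> h z \<longrightarrow> (cX f, cY g) \<in> pol_R PU)"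
    unfolding rho_def pol_Y_PU using assms(1) h_sub by blast
  also have "\<dots> \<longleftrightarrow> (\<forall>f \<in> I \<rightarrow>\<^sub>E X. phi f \<sqsubseteq>\<^bsub>C\<^esub> z \<longrightarrow> (\<forall>\<^sub>F i in U. (f i, g i) \<in> R))"
    using ultrapower_rel_iff[OF _ assms(1)] h_iff[OF _ assms(2)] by blast
  also have "\<dots> \<longleftrightarrow> z \<sqsubseteq>\<^bsub>C\<^esub> psi g" (is "?l \<longleftrightarrow> ?r")
  proof
    assume l: ?l
    show ?r
    proof (rule ccontr)
      assume "\<not> ?r"
      with assms show False by (rule unrelated_below) (use l in blast)
    qed
  qed (use related_if_between[OF _ assms(2) _ _ assms(1)] in blast)
  finally show ?thesis .
qed

lemma stable_h: "stable_set PU (h z)"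
  unfolding h_def by (rule stable_lam) (auto simp: up_def pol_Y_PU)

lemma h_meet:
  assumes "z \<in> carrier C" "w \<in> carrier C"
  shows "h (z \<sqinter>\<^bsub>C\<^esub> w) = h z \<inter> h w"
proof -
  have "phi f \<sqsubseteq>\<^bsub>C\<^esub> z \<sqinter>\<^bsub>C\<^esub> w \<longleftrightarrow> phi f \<sqsubseteq>\<^bsub>C\<^esub> z \<and> phi f \<sqsubseteq>\<^bsub>C\<^esub> w" for f
    using assms C.meet_le[of "phi f" z w] C.le_trans[OF _ C.meet_left[OF assms], of "phi f"]
      C.le_trans[OF _ C.meet_right[OF assms], of "phi f"] by auto
  then have "cX f \<in> h (z \<sqinter>\<^bsub>C\<^esub> w) \<longleftrightarrow> cX f \<in> h z \<inter> h w" if "f \<in> I \<rightarrow>\<^sub>E X" for f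
    using that assms by (simp add: h_iff)
  then show ?thesis using h_sub by blast
qed

text \<open>A join of stable sets is determined by the intersection of their \<open>rho\<close>
  images, and there \<open>rho_h_iff\<close> turns the join of \<open>z\<close> and \<open>w\<close>
  into a conjunction.\<close>

lemma h_join:
  assumes "z \<in> carrier C" "w \<in> carrier C"
  shows "h (z \<squnion>\<^bsub>C\<^esub> w) = lam PU (rho PU (h z \<union> h w))"
proof -
  have "z \<squnion>\<^bsub>C\<^esub> w \<sqsubseteq>\<^bsub>C\<^esub> psi g \<longleftrightarrow> z \<sqsubseteq>\<^bsub>C\<^esub> psi g \<and> w \<sqsubseteq>\<^bsub>C\<^esub> psi g" for g
    using assms C.join_le[of z "psi g" w] C.le_trans[OF C.join_left[OF assms], of "psi g"]
      C.le_trans[OF C.join_right[OF assms], of "psi g"] by auto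
  then have "cY g \<in> rho PU (h (z \<squnion>\<^bsub>C\<^esub> w)) \<longleftrightarrow> cY g \<in> rho PU (h z) \<inter> rho PU (h w)"
    if "g \<in> I \<rightarrow>\<^sub>E Y" for g
    using that assms by (simp add: rho_h_iff)
  moreover have "rho PU (h z') \<subseteq> cY ` (I \<rightarrow>\<^sub>E Y)" for z'
    unfolding rho_def pol_Y_PU by blast
  ultimately have "rho PU (h (z \<squnion>\<^bsub>C\<^esub> w)) = rho PU (h z) \<inter> rho PU (h w)" by blast
  also have "\<dots> = rho PU (h z \<union> h w)" by (auto simp: rho_def)
  finally show ?thesis using stable_h[of "z \<squnion>\<^bsub>C\<^esub> w"] unfolding stable_set_def by simp
qed

text \<open>For \<open>z\<close> not below \<open>w\<close> there is an unrelated pair with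
  \<open>f\<close> in \<open>h z\<close>; equality with \<open>h w\<close> would place
  \<open>w\<close> between \<open>phi f\<close> and \<open>psi g\<close> and make the pair
  related.\<close>

lemma inj_on_h: "inj_on h (carrier C)"
proof (rule inj_onI)
  have le: "z \<sqsubseteq>\<^bsub>C\<^esub> w" if zw: "z \<in> carrier C" "w \<in> carrier C" "h z = h w" for z w
  proof (rule ccontr)
    assume "\<not> z \<sqsubseteq>\<^bsub>C\<^esub> w"
    then obtain f g where fg: "f \<in> I \<rightarrow>\<^sub>E X" "g \<in> I \<rightarrow>\<^sub>E Y" "phi f \<sqsubseteq>\<^bsub>C\<^esub> z" "w \<sqsubseteq>\<^bsub>C\<^esub> psi g"
      "\<not> (\<forall>\<^sub>F i in U. (f i, g i) \<in> R)"
      using unrelated_between[OF zw(1,2)] by blast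
    have "phi f \<sqsubseteq>\<^bsub>C\<^esub> w" using fg(1,3) zw h_iff by blast
    then show False using related_if_between[OF fg(1) zw(2)] fg by blast
  qed
  fix z w assume "z \<in> carrier C" "w \<in> carrier C" "h z = h w"
  then show "z = w" using le[of z w] le[of w z] C.le_antisym by simp
qed

theorem lattice_embedding_h: "lattice_embedding C (stable_lattice PU) h"
proof -
  let ?M = "stable_lattice PU"
  have M: "complete_lattice ?M" by (rule complete_lattice_stable_lattice)
  interpret M: complete_lattice ?M by (rule M)
  have hc: "h z \<in> carrier ?M" for z using stable_h by (simp add: stable_lattice_def)
  have "h (z \<squnion>\<^bsub>C\<^esub> w) = h z \<squnion>\<^bsub>?M\<^esub> h w" if "z \<in> carrier C" "w \<in> carrier C" for z w
    using h_join[OF that] hc stable_lattice_sup[of "{h z, h w}" PU] unfolding join_def by simp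
  moreover have "h (z \<sqinter>\<^bsub>C\<^esub> w) = h z \<sqinter>\<^bsub>?M\<^esub> h w" if "z \<in> carrier C" "w \<in> carrier C" for z w
  proof -
    have "pol_X PU \<inter> (h z \<inter> h w) = h z \<inter> h w"
      using stable_h[of z] unfolding stable_set_def by blast
    then show ?thesis
      using h_meet[OF that] hc stable_lattice_inf[of "{h z, h w}" PU] unfolding meet_def by simp
  qed
  moreover have "h \<bottom>\<^bsub>C\<^esub> = \<bottom>\<^bsub>?M\<^esub>"
  proof (rule M.le_antisym)
    have "up \<bottom>\<^bsub>C\<^esub> = pol_Y PU" unfolding up_def pol_Y_PU by simp
    then have "h \<bottom>\<^bsub>C\<^esub> \<subseteq> lam PU (rho PU \<bottom>\<^bsub>?M\<^esub>)"
      unfolding h_def by (auto simp: lam_def rho_def)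
    then show "h \<bottom>\<^bsub>C\<^esub> \<sqsubseteq>\<^bsub>?M\<^esub> \<bottom>\<^bsub>?M\<^esub>"
      using M.bottom_closed by (simp add: stable_lattice_def stable_set_def)
  qed (use hc M.bottom_lower in auto)
  moreover have "h \<top>\<^bsub>C\<^esub> = \<top>\<^bsub>?M\<^esub>"
  proof (rule M.le_antisym)
    have "cX f \<in> h \<top>\<^bsub>C\<^esub>" if "f \<in> I \<rightarrow>\<^sub>E X" for f using that by (simp add: h_iff)
    then have "pol_X PU \<subseteq> h \<top>\<^bsub>C\<^esub>" unfolding pol_X_PU by blast
    then show "\<top>\<^bsub>?M\<^esub> \<sqsubseteq>\<^bsub>?M\<^esub> h \<top>\<^bsub>C\<^esub>"
      using M.top_closed by (auto simp: stable_lattice_def stable_set_def)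
  qed (use hc M.top_higher in auto)
  ultimately show ?thesis
    unfolding lattice_embedding_def join_pres_def meet_pres_def
    using bounded_lattice_of_complete[OF complete_C] bounded_lattice_of_complete[OF M]
      C.lattice_axioms M.lattice_axioms hc inj_on_h by auto
qed

end

theorem theorem6p2:
  fixes P :: "('x, 'y) polarity"
  assumes "is_polarity P"
  shows "\<exists>(I :: ('x + nat) set set set) (U :: ('x + nat) set set filter).
           ultrafilter_on I U \<and>
           (\<forall>(C :: 'c gorder) e. canonical_extension (stable_lattice P) C e \<longrightarrow>
              (\<exists>h. lattice_embedding C (stable_lattice (ultrapower I U P)) h))"
proof -
  \<comment> \<open>The type \<open>('x + nat) set\<close> serves as \<open>'b\<close>: the summand
    \<open>nat\<close> makes it infinite for every \<open>'x\<close>, and images under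
    \<open>Inl\<close> embed \<open>'x set\<close>.\<close>
  have "inj (\<lambda>n. {Inr n} :: ('x + nat) set)" by (simp add: inj_def)
  then have inf: "infinite (UNIV :: ('x + nat) set set)"
    using finite_imageD finite_subset[OF subset_UNIV] infinite_UNIV_nat by metis
  have inj: "inj (\<lambda>A :: 'x set. Inl ` A :: ('x + nat) set)"
    by (rule injI) (simp add: inj_image_eq_iff)
  obtain I and U :: "('x + nat) set set filter"
    where U: "ultrafilter_on I U" "good_filter TYPE('x set) U"
    by (rule good_ultrafilter_exists[OF inf inj])
  have "\<exists>h. lattice_embedding C (stable_lattice (ultrapower I U P)) h"
    if "canonical_extension (stable_lattice P) C e" for C :: "'c gorder" and e
  proof -
    interpret good_ultrapower P I U C e by unfold_locales (use U that in auto)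
    show ?thesis using lattice_embedding_h by blast
  qed
  then show ?thesis using U(1) by blast
qed

end
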